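(* Let $\Theta$ be a non-empty set and let $(H_\theta)_{\theta\in\Theta}$, $(M(\theta))_{\theta\in\Theta}$, $(A(\theta))_{\theta\in\Theta}$, $c>0$, $(N(\theta))_{\theta\in\Theta}$ satisfy the standing assumptions and the fibre hypothesis stated in the context. Let $\varepsilon_0:=1/(2C_R\|M\|_\infty)$ and $$\mathcal{B}_{\varepsilon,N}(\theta):=\iota_{N(\theta)}^*M(\theta)\iota_{N(\theta)}+\tfrac1\varepsilon\,\iota_{N(\theta)}^*A(\theta)\iota_{N(\theta)}\in L(N(\theta)).$$ Then for all $\varepsilon\in(0,\varepsilon_0)$ and $\theta\in\Theta$ the inequality $$\big\|\mathcal{B}_\varepsilon(\theta)^{-1}-\iota_{N(\theta)}\,\mathcal{B}_{\varepsilon,N}(\theta)^{-1}\,\iota_{N(\theta)}^*\big\|\le 2C_R\Big(1+\frac{\|M\|_\infty}{c}\Big)^2\varepsilon$$ holds.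
   Context: Standing assumptions. $\Theta$ is a non-empty set, $(H_\theta)_{\theta\in\Theta}$ is a family of Hilbert spaces, $M(\theta)\in L(H_\theta)$ (bounded linear operators) with $\|M\|_\infty:=\sup_{\theta\in\Theta}\|M(\theta)\|<\infty$, and $A(\theta):\operatorname{dom}(A(\theta))\subseteq H_\theta\to H_\theta$ is densely defined and closed. There is $c\in(0,\infty)$ such that for all $\theta\in\Theta$: $\operatorname{Re}M(\theta):=\tfrac12(M(\theta)+M(\theta)^* )\ge c$ and $A(\theta)=-A(\theta)^*$. For $\varepsilon>0$ put $\mathcal{B}_\varepsilon(\theta):=M(\theta)+\tfrac1\varepsilon A(\theta)$ with domain $\operatorname{dom}(A(\theta))$. Fibre hypothesis. For every $\theta\in\Theta$ there is given a closed subspace $N(\theta)\subseteq H_\theta$; put $R(\theta):=N(\theta)^\perp$, let $\iota_{N(\theta)}:N(\theta)\hookrightarrow H_\theta$, $\iota_{R(\theta)}:R(\theta)\hookrightarrow H_\theta$ be the canonical embeddings and $\pi_{N(\theta)}:=\iota_{N(\theta)}\iota_{N(\theta)}^*$, $\pi_{R(\theta)}:=\iota_{R(\theta)}\iota_{R(\theta)}^*$ the orthogonal projections, such that (a) $A(\theta)\pi_{N(\theta)}$ is bounded for all $\theta\in\Theta$; (b) $\pi_{R(\theta)}A(\theta)\subseteq A(\theta)\pi_{R(\theta)}$ (inclusion of operators) for all $\theta\in\Theta$; (c) $\iota_{R(\theta)}^*A(\theta)\iota_{R(\theta)}$ is boundedly invertible on $R(\theta)$, uniformly in $\theta$: $C_R:=\sup_{\theta\in\Theta}\|(\iota_{R(\theta)}^*A(\theta)\iota_{R(\theta)})^{-1}\|_{L(R(\theta))}<\infty$.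 *)

theory Defs
  imports "HOL-Analysis.Analysis" "HOL-Algebra.Module" "HOL-Algebra.Algebraic_Closure_Type"
begin

section \<open>Complex Hilbert spaces\<close>

text \<open>
  Hilbert spaces are carrier-based, so that the members of a family of Hilbert spaces may have
  different carriers, operations and inner products. The underlying vector space is a module of
  HOL-Algebra over the field of complex numbers (the ring components \<open>mult\<close> and \<open>one\<close> of the
  record are not used). The inner product is linear in the first argument.
\<close>

record 'a inner_space = "(complex, 'a) module" +
  cinner :: "'a \<Rightarrow> 'a \<Rightarrow> complex"  (\<open>(\<open>notation=\<open>mixfix cinner\<close>\<close>\<langle>_,/ _\<rangle>\<index>)\<close>)

definition hnorm :: "'a inner_space \<Rightarrow> 'a \<Rightarrow> real" where
  "hnorm H x = sqrt (Re (\<langle>x, x\<rangle>\<^bsub>H\<^esub>))"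

text \<open>The value 0 off the carrier is needed because the library locale \<open>Metric_space\<close> asks the
  distance function to be non-negative and symmetric on the whole type.\<close>

definition hdist :: "'a inner_space \<Rightarrow> 'a \<Rightarrow> 'a \<Rightarrow> real" where
  "hdist H x y = (if x \<in> carrier H \<and> y \<in> carrier H then hnorm H (x \<ominus>\<^bsub>H\<^esub> y) else 0)"

definition htopology :: "'a inner_space \<Rightarrow> 'a topology" where
  "htopology H = Metric_space.mtopology (carrier H) (hdist H)"

locale complex_inner_product_space =
  module "ring_of_type_algebra :: complex ring" H for H :: "'a inner_space" (structure) +
  assumes cinner_add_left:
      "\<lbrakk>x \<in> carrier H; y \<in> carrier H; z \<in> carrier H\<rbrakk> \<Longrightarrow> \<langle>x \<oplus> y, z\<rangle> = \<langle>x, z\<rangle> + \<langle>y, z\<rangle>"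
    and cinner_smult_left:
      "\<lbrakk>x \<in> carrier H; y \<in> carrier H\<rbrakk> \<Longrightarrow> \<langle>a \<odot> x, y\<rangle> = a * \<langle>x, y\<rangle>"
    and cinner_commute:
      "\<lbrakk>x \<in> carrier H; y \<in> carrier H\<rbrakk> \<Longrightarrow> \<langle>y, x\<rangle> = cnj \<langle>x, y\<rangle>"
    and cinner_ge_zero:
      "x \<in> carrier H \<Longrightarrow> 0 \<le> Re \<langle>x, x\<rangle>"
    and cinner_eq_zero:
      "\<lbrakk>x \<in> carrier H; \<langle>x, x\<rangle> = 0\<rbrakk> \<Longrightarrow> x = \<zero>"

locale complex_hilbert_space = complex_inner_product_space +
  assumes complete: "Metric_space.mcomplete (carrier H) (hdist H)"

definition closed_subspace :: "'a inner_space \<Rightarrow> 'a set \<Rightarrow> bool" where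
  "closed_subspace H N \<longleftrightarrow>
     submodule N (ring_of_type_algebra :: complex ring) H \<and> closedin (htopology H) N"

definition orth_complement :: "'a inner_space \<Rightarrow> 'a set \<Rightarrow> 'a set" where
  "orth_complement H N = {x \<in> carrier H. \<forall>y\<in>N. \<langle>x, y\<rangle>\<^bsub>H\<^esub> = 0}"

text \<open>A subspace, regarded as a space in its own right with the inherited structure.\<close>

definition subsp :: "'a inner_space \<Rightarrow> 'a set \<Rightarrow> 'a inner_space" where
  "subsp H N = H\<lparr>carrier := N\<rparr>"


section \<open>Operators\<close>

text \<open>
  An operator from \<open>H\<close> to \<open>K\<close>, possibly not everywhere defined, is identified with its graph
  \<open>T \<subseteq> carrier H \<times> carrier K\<close>. Thus \<open>Domain T\<close> is its domain, \<open>T\<inverse>\<close> its inverse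
  (which need not be an operator), and inclusion of operators is \<open>\<subseteq>\<close>.
\<close>

type_synonym 'a op_graph = "('a \<times> 'a) set"

definition linear_operator :: "'a inner_space \<Rightarrow> 'a inner_space \<Rightarrow> 'a op_graph \<Rightarrow> bool" where
  "linear_operator H K T \<longleftrightarrow>
     T \<subseteq> carrier H \<times> carrier K \<and> single_valued T \<and> (\<zero>\<^bsub>H\<^esub>, \<zero>\<^bsub>K\<^esub>) \<in> T \<and>
     (\<forall>(x, y)\<in>T. \<forall>(x', y')\<in>T. (x \<oplus>\<^bsub>H\<^esub> x', y \<oplus>\<^bsub>K\<^esub> y') \<in> T) \<and>
     (\<forall>a. \<forall>(x, y)\<in>T. (a \<odot>\<^bsub>H\<^esub> x, a \<odot>\<^bsub>K\<^esub> y) \<in> T)"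

definition densely_defined :: "'a inner_space \<Rightarrow> 'a op_graph \<Rightarrow> bool" where
  "densely_defined H T \<longleftrightarrow> (htopology H) closure_of (Domain T) = carrier H"

definition closed_operator :: "'a inner_space \<Rightarrow> 'a inner_space \<Rightarrow> 'a op_graph \<Rightarrow> bool" where
  "closed_operator H K T \<longleftrightarrow> closedin (prod_topology (htopology H) (htopology K)) T"

text \<open>The operator norm of \<open>T\<close> on its domain, \<open>\<infinity>\<close> if \<open>T\<close> is unbounded.\<close>

definition opnorm :: "'a inner_space \<Rightarrow> 'a inner_space \<Rightarrow> 'a op_graph \<Rightarrow> ennreal" where
  "opnorm H K T = (SUP (x, y) \<in> {(x, y) \<in> T. hnorm H x \<le> 1}. ennreal (hnorm K y))"

definition bounded_ops :: "'a inner_space \<Rightarrow> 'a inner_space \<Rightarrow> 'a op_graph set" where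
  "bounded_ops H K =
     {T. linear_operator H K T \<and> Domain T = carrier H \<and> opnorm H K T < \<infinity>}"

definition op_comp :: "'a op_graph \<Rightarrow> 'a op_graph \<Rightarrow> 'a op_graph"  (infixr \<open>\<cdot>\<^sub>o\<close> 75) where
  "S \<cdot>\<^sub>o T = T O S"

definition op_add :: "'a inner_space \<Rightarrow> 'a op_graph \<Rightarrow> 'a op_graph \<Rightarrow> 'a op_graph" where
  "op_add K S T = {(x, y \<oplus>\<^bsub>K\<^esub> z) | x y z. (x, y) \<in> S \<and> (x, z) \<in> T}"

definition op_smult :: "'a inner_space \<Rightarrow> complex \<Rightarrow> 'a op_graph \<Rightarrow> 'a op_graph" where
  "op_smult K a T = {(x, a \<odot>\<^bsub>K\<^esub> y) | x y. (x, y) \<in> T}"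

definition op_uminus :: "'a inner_space \<Rightarrow> 'a op_graph \<Rightarrow> 'a op_graph" where
  "op_uminus K T = {(x, \<ominus>\<^bsub>K\<^esub> y) | x y. (x, y) \<in> T}"

definition op_diff :: "'a inner_space \<Rightarrow> 'a op_graph \<Rightarrow> 'a op_graph \<Rightarrow> 'a op_graph" where
  "op_diff K S T = op_add K S (op_uminus K T)"

text \<open>The adjoint of an operator from \<open>H\<close> to \<open>K\<close>, an operator from \<open>K\<close> to \<open>H\<close> with its maximal
  domain; the relation is single-valued if \<open>T\<close> is densely defined.\<close>

definition adjoint_op :: "'a inner_space \<Rightarrow> 'a inner_space \<Rightarrow> 'a op_graph \<Rightarrow> 'a op_graph" where
  "adjoint_op H K T =
     {(y, z). y \<in> carrier K \<and> z \<in> carrier H \<and> (\<forall>(x, w)\<in>T. \<langle>w, y\<rangle>\<^bsub>K\<^esub> = \<langle>x, z\<rangle>\<^bsub>H\<^esub>)}"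

definition re_op :: "'a inner_space \<Rightarrow> 'a op_graph \<Rightarrow> 'a op_graph" where
  "re_op H T = op_smult H (1 / 2) (op_add H T (adjoint_op H H T))"

text \<open>\<open>T \<ge> c\<close> in the sense of quadratic forms. It is used for \<open>re_op H M\<close> with \<open>M\<close> bounded, which
  is self-adjoint, so that \<open>\<langle>T x, x\<rangle>\<close> is real.\<close>

definition op_ge :: "'a inner_space \<Rightarrow> 'a op_graph \<Rightarrow> real \<Rightarrow> bool" where
  "op_ge H T c \<longleftrightarrow> (\<forall>(x, y)\<in>T. c * (hnorm H x)\<^sup>2 \<le> Re \<langle>y, x\<rangle>\<^bsub>H\<^esub>)"


section \<open>Embeddings, projections and compressions\<close>

definition emb :: "'a set \<Rightarrow> 'a op_graph" where
  "emb N = Id_on N"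

definition emb_adj :: "'a inner_space \<Rightarrow> 'a set \<Rightarrow> 'a op_graph" where
  "emb_adj H N = adjoint_op (subsp H N) H (emb N)"

definition orth_proj :: "'a inner_space \<Rightarrow> 'a set \<Rightarrow> 'a op_graph" where
  "orth_proj H N = emb N \<cdot>\<^sub>o emb_adj H N"

definition compression :: "'a inner_space \<Rightarrow> 'a set \<Rightarrow> 'a op_graph \<Rightarrow> 'a op_graph" where
  "compression H N T = emb_adj H N \<cdot>\<^sub>o T \<cdot>\<^sub>o emb N"


section \<open>The operators \<open>M + A/\<epsilon>\<close>\<close>

definition B_op :: "'a inner_space \<Rightarrow> 'a op_graph \<Rightarrow> 'a op_graph \<Rightarrow> real \<Rightarrow> 'a op_graph" where
  "B_op H M A \<epsilon> = op_add H M (op_smult H (complex_of_real (1 / \<epsilon>)) A)"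

definition BN_op ::
  "'a inner_space \<Rightarrow> 'a set \<Rightarrow> 'a op_graph \<Rightarrow> 'a op_graph \<Rightarrow> real \<Rightarrow> 'a op_graph" where
  "BN_op H N M A \<epsilon> =
     op_add (subsp H N) (compression H N M)
       (op_smult (subsp H N) (complex_of_real (1 / \<epsilon>)) (compression H N A))"

end

theory Submission
  imports Defs
begin

text \<open>
  Everything happens in one fibre \<open>H\<close>, with \<open>m\<close> and \<open>C\<close> bounding \<open>\<parallel>M\<parallel>\<close> and the norm of the inverse of \<open>A\<close> on
  \<open>R\<close>. Since \<open>A = - A\<^sup>*\<close>, the real part of \<open>\<langle>A x, x\<rangle>\<close> vanishes, so \<open>M + A / \<epsilon>\<close> is bounded below by the constant
  \<open>c\<close> of \<open>M\<close>, whatever \<open>\<epsilon>\<close> is. Its range is closed, and it is dense because the adjoint is bounded below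
  in the same way; so \<open>M + A / \<epsilon>\<close> has a bounded inverse of norm at most \<open>1 / c\<close>
  (\<open>B_op_inverse_bounded\<close>). The projection theorem and the Riesz representation enter here, the
  latter because coercivity of \<open>M\<close> is given through \<open>M\<^sup>*\<close>.

  The inclusion \<open>\<pi>\<^sub>R A \<subseteq> A \<pi>\<^sub>R\<close> makes \<open>A\<close> block diagonal for \<open>N \<oplus> R\<close> (\<open>A_blocks\<close>). Its block on \<open>N\<close> is
  skew-selfadjoint in the Hilbert space \<open>N\<close>, and bounded because \<open>A\<close> is closed and densely
  defined; so the same theorem inverts the operator on \<open>N\<close>.

  For the estimate, compare the solution \<open>x\<close> of \<open>M x + A x / \<epsilon> = f\<close> with the solution \<open>u\<close> of the problem
  on \<open>N\<close>. In the \<open>R\<close>-block the equation determines \<open>A x\<^sub>R = \<epsilon> \<pi>\<^sub>R (f - M x)\<close>, so \<open>x\<^sub>R\<close> is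
  of order \<open>\<epsilon>\<close>; in the \<open>N\<close>-block \<open>x\<^sub>N\<close> solves the same problem as \<open>u\<close> up to the error \<open>\<pi>\<^sub>N M x\<^sub>R\<close>, which
  coercivity carries over to \<open>x\<^sub>N - u\<close>. Each of the two steps costs a factor \<open>1 + m / c\<close>
  (\<open>resolvent_difference_bound\<close>).
\<close>

section \<open>Inner product spaces\<close>

lemma type_algebra_simps [simp]:
  "carrier (ring_of_type_algebra :: complex ring) = UNIV"
  "a \<oplus>\<^bsub>ring_of_type_algebra :: complex ring\<^esub> b = a + b"
  "a \<otimes>\<^bsub>ring_of_type_algebra :: complex ring\<^esub> b = a * b"
  "\<zero>\<^bsub>ring_of_type_algebra :: complex ring\<^esub> = 0"
  "\<one>\<^bsub>ring_of_type_algebra :: complex ring\<^esub> = 1"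
  by (simp_all add: ring_of_type_algebra_def)

context complex_inner_product_space
begin

lemma smult_in_carrier [simp]: "x \<in> carrier H \<Longrightarrow> a \<odot> x \<in> carrier H"
  using smult_closed[of a x] by simp

lemma smult_zero_left [simp]: "x \<in> carrier H \<Longrightarrow> 0 \<odot> x = \<zero>"
  using smult_l_null[of x] by simp

lemma cinner_zero_left [simp]: "y \<in> carrier H \<Longrightarrow> \<langle>\<zero>, y\<rangle> = 0"
  using cinner_add_left[of \<zero> \<zero> y] by simp

lemma cinner_uminus_left: "x \<in> carrier H \<Longrightarrow> y \<in> carrier H \<Longrightarrow> \<langle>\<ominus> x, y\<rangle> = - \<langle>x, y\<rangle>"
  using cinner_add_left[of x "\<ominus> x" y] by (simp add: r_neg eq_neg_iff_add_eq_0 add.commute)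

lemma cinner_minus_left:
  "x \<in> carrier H \<Longrightarrow> y \<in> carrier H \<Longrightarrow> z \<in> carrier H \<Longrightarrow> \<langle>x \<ominus> y, z\<rangle> = \<langle>x, z\<rangle> - \<langle>y, z\<rangle>"
  by (simp add: minus_eq cinner_add_left cinner_uminus_left)

lemma cinner_zero_right [simp]: "x \<in> carrier H \<Longrightarrow> \<langle>x, \<zero>\<rangle> = 0"
  using cinner_commute[of \<zero> x] by simp

lemma cinner_add_right:
  "x \<in> carrier H \<Longrightarrow> y \<in> carrier H \<Longrightarrow> z \<in> carrier H \<Longrightarrow> \<langle>x, y \<oplus> z\<rangle> = \<langle>x, y\<rangle> + \<langle>x, z\<rangle>"
  using cinner_commute[of "y \<oplus> z" x] cinner_commute[of y x] cinner_commute[of z x]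
  by (simp add: cinner_add_left)

lemma cinner_smult_right:
  "x \<in> carrier H \<Longrightarrow> y \<in> carrier H \<Longrightarrow> \<langle>x, a \<odot> y\<rangle> = cnj a * \<langle>x, y\<rangle>"
  using cinner_commute[of "a \<odot> y" x] cinner_commute[of y x] by (simp add: cinner_smult_left)

lemma cinner_uminus_right: "x \<in> carrier H \<Longrightarrow> y \<in> carrier H \<Longrightarrow> \<langle>x, \<ominus> y\<rangle> = - \<langle>x, y\<rangle>"
  using cinner_commute[of "\<ominus> y" x] cinner_commute[of y x] by (simp add: cinner_uminus_left)

lemma cinner_minus_right:
  "x \<in> carrier H \<Longrightarrow> y \<in> carrier H \<Longrightarrow> z \<in> carrier H \<Longrightarrow> \<langle>x, y \<ominus> z\<rangle> = \<langle>x, y\<rangle> - \<langle>x, z\<rangle>"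
  by (simp add: minus_eq cinner_add_right cinner_uminus_right)

lemmas cinner_linear = cinner_add_left cinner_smult_left cinner_uminus_left cinner_minus_left
  cinner_add_right cinner_smult_right cinner_uminus_right cinner_minus_right

lemma minus_eq_zero_iff: "x \<in> carrier H \<Longrightarrow> y \<in> carrier H \<Longrightarrow> x \<ominus> y = \<zero> \<longleftrightarrow> x = y"
  by (metis add.inv_solve_right' l_zero minus_eq r_neg zero_closed)

lemma eq_if_cinner_eq:
  assumes "x \<in> carrier H" "y \<in> carrier H" "\<And>z. z \<in> carrier H \<Longrightarrow> \<langle>x, z\<rangle> = \<langle>y, z\<rangle>"
  shows "x = y"
proof -
  have "\<langle>x \<ominus> y, x \<ominus> y\<rangle> = 0"
    using assms(1,2) assms(3)[of "x \<ominus> y"] by (simp only: cinner_minus_left minus_closed) simp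
  then have "x \<ominus> y = \<zero>" using cinner_eq_zero[of "x \<ominus> y"] assms by simp
  then show ?thesis using assms(1,2) by (simp add: minus_eq_zero_iff)
qed

lemma cinner_self: "x \<in> carrier H \<Longrightarrow> \<langle>x, x\<rangle> = complex_of_real ((hnorm H x)\<^sup>2)"
proof -
  assume x: "x \<in> carrier H"
  have "Im \<langle>x, x\<rangle> = 0" using arg_cong[OF cinner_commute[OF x x], of Im] by simp
  then show ?thesis using cinner_ge_zero[OF x] by (simp add: hnorm_def complex_eq_iff)
qed

lemma hnorm_sq: "x \<in> carrier H \<Longrightarrow> (hnorm H x)\<^sup>2 = Re \<langle>x, x\<rangle>"
  by (simp add: cinner_self)

lemma hnorm_nonneg [simp]: "x \<in> carrier H \<Longrightarrow> 0 \<le> hnorm H x"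
  by (simp add: hnorm_def cinner_ge_zero)

lemma hnorm_zero [simp]: "hnorm H \<zero> = 0"
  by (simp add: hnorm_def)

lemma hnorm_eq_zero: "x \<in> carrier H \<Longrightarrow> hnorm H x = 0 \<longleftrightarrow> x = \<zero>"
  using cinner_eq_zero[of x] by (auto simp: cinner_self)

lemma hnorm_smult: "x \<in> carrier H \<Longrightarrow> hnorm H (a \<odot> x) = cmod a * hnorm H x"
proof -
  assume x: "x \<in> carrier H"
  have "\<langle>a \<odot> x, a \<odot> x\<rangle> = a * cnj a * \<langle>x, x\<rangle>"
    using x by (simp add: cinner_linear)
  also have "\<dots> = complex_of_real ((cmod a * hnorm H x)\<^sup>2)"
    using x by (simp only: complex_norm_square[symmetric] cinner_self power_mult_distrib of_real_mult)
  finally have "(hnorm H (a \<odot> x))\<^sup>2 = (cmod a * hnorm H x)\<^sup>2"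
    using x by (simp only: cinner_self smult_in_carrier of_real_eq_iff)
  then show ?thesis using x by (simp add: power2_eq_iff_nonneg)
qed

lemma hnorm_uminus [simp]: "x \<in> carrier H \<Longrightarrow> hnorm H (\<ominus> x) = hnorm H x"
  by (simp add: hnorm_def cinner_linear)

lemma hnorm_minus_commute: "x \<in> carrier H \<Longrightarrow> y \<in> carrier H \<Longrightarrow> hnorm H (x \<ominus> y) = hnorm H (y \<ominus> x)"
  by (simp add: hnorm_def cinner_linear algebra_simps)

lemma hnorm_add_sq:
  assumes "x \<in> carrier H" "y \<in> carrier H"
  shows "(hnorm H (x \<oplus> y))\<^sup>2 = (hnorm H x)\<^sup>2 + 2 * Re \<langle>x, y\<rangle> + (hnorm H y)\<^sup>2"
  using assms cinner_commute[OF assms] by (simp add: hnorm_sq cinner_linear)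

lemma hnorm_minus_sq:
  assumes "x \<in> carrier H" "y \<in> carrier H"
  shows "(hnorm H (x \<ominus> y))\<^sup>2 = (hnorm H x)\<^sup>2 - 2 * Re \<langle>x, y\<rangle> + (hnorm H y)\<^sup>2"
  using assms cinner_commute[OF assms] by (simp add: hnorm_sq cinner_linear)

text \<open>Subtracting from \<open>x\<close> its component along \<open>y\<close> decreases the squared norm by exactly
  \<open>\<bar>\<langle>x, y\<rangle>\<bar>\<^sup>2 / \<parallel>y\<parallel>\<^sup>2\<close>. This gives the Cauchy-Schwarz inequality, and also shows that a nearest point in a
  subspace is an orthogonal projection.\<close>

lemma hnorm_remove_component_sq:
  assumes x: "x \<in> carrier H" and y: "y \<in> carrier H" and "y \<noteq> \<zero>"
  defines "t \<equiv> \<langle>x, y\<rangle> / complex_of_real ((hnorm H y)\<^sup>2)"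
  shows "(hnorm H (x \<ominus> t \<odot> y))\<^sup>2 = (hnorm H x)\<^sup>2 - (cmod \<langle>x, y\<rangle>)\<^sup>2 / (hnorm H y)\<^sup>2"
proof -
  have ny: "hnorm H y \<noteq> 0" using assms by (simp add: hnorm_eq_zero)
  have "Re (cnj t * \<langle>x, y\<rangle>) = (cmod \<langle>x, y\<rangle>)\<^sup>2 / (hnorm H y)\<^sup>2"
    by (simp add: t_def cmod_def Re_divide_of_real power2_eq_square add_divide_distrib
        flip: of_real_power of_real_mult)
  moreover have "(cmod t * hnorm H y)\<^sup>2 = (cmod \<langle>x, y\<rangle>)\<^sup>2 / (hnorm H y)\<^sup>2"
    using ny by (simp add: t_def norm_divide norm_power power_divide power2_eq_square norm_mult)
  ultimately show ?thesis
    using x y by (simp add: hnorm_minus_sq cinner_linear hnorm_smult)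
qed

lemma Cauchy_Schwarz:
  assumes "x \<in> carrier H" "y \<in> carrier H"
  shows "cmod \<langle>x, y\<rangle> \<le> hnorm H x * hnorm H y"
proof (cases "y = \<zero>")
  case False
  then have pos: "hnorm H y > 0" using assms hnorm_eq_zero[of y] hnorm_nonneg[of y] by linarith
  have "(cmod \<langle>x, y\<rangle>)\<^sup>2 / (hnorm H y)\<^sup>2 \<le> (hnorm H x)\<^sup>2"
    using hnorm_remove_component_sq[OF assms False] by (metis diff_ge_0_iff_ge zero_le_power2)
  then have "(cmod \<langle>x, y\<rangle>)\<^sup>2 \<le> (hnorm H x * hnorm H y)\<^sup>2"
    using pos by (simp add: field_simps power_mult_distrib)
  then show ?thesis using assms by (simp add: power2_le_iff_abs_le)
qed (use assms in simp)

lemma Re_cinner_le: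
  "x \<in> carrier H \<Longrightarrow> y \<in> carrier H \<Longrightarrow> Re \<langle>x, y\<rangle> \<le> hnorm H x * hnorm H y"
  using Cauchy_Schwarz[of x y] complex_Re_le_cmod[of "\<langle>x, y\<rangle>"] by linarith

lemma hnorm_triangle:
  assumes "x \<in> carrier H" "y \<in> carrier H"
  shows "hnorm H (x \<oplus> y) \<le> hnorm H x + hnorm H y"
proof (rule power2_le_imp_le)
  show "(hnorm H (x \<oplus> y))\<^sup>2 \<le> (hnorm H x + hnorm H y)\<^sup>2"
    using Re_cinner_le[OF assms] assms by (simp add: hnorm_add_sq power2_sum)
qed (use assms in simp)

lemma hnorm_triangle_minus:
  assumes "x \<in> carrier H" "y \<in> carrier H"
  shows "hnorm H (x \<ominus> y) \<le> hnorm H x + hnorm H y"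
  using hnorm_triangle[of x "\<ominus> y"] assms by (simp add: minus_eq)

lemma minus_split:
  "x \<in> carrier H \<Longrightarrow> y \<in> carrier H \<Longrightarrow> z \<in> carrier H \<Longrightarrow> x \<ominus> z = (x \<ominus> y) \<oplus> (y \<ominus> z)"
  by (rule eq_if_cinner_eq) (simp_all add: cinner_linear)

lemma hnorm_minus_triangle:
  assumes "x \<in> carrier H" "y \<in> carrier H" "z \<in> carrier H"
  shows "hnorm H (x \<ominus> z) \<le> hnorm H (x \<ominus> y) + hnorm H (y \<ominus> z)"
  using hnorm_triangle[of "x \<ominus> y" "y \<ominus> z"] minus_split[OF assms] assms by simp

lemma Metric_space_hdist: "Metric_space (carrier H) (hdist H)"
proof
  show "0 \<le> hdist H x y" for x y by (simp add: hdist_def)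
  show "hdist H x y = hdist H y x" for x y by (simp add: hdist_def hnorm_minus_commute)
  show "hdist H x y = 0 \<longleftrightarrow> x = y" if "x \<in> carrier H" "y \<in> carrier H" for x y
    using that by (simp add: hdist_def hnorm_eq_zero minus_eq_zero_iff)
  show "hdist H x z \<le> hdist H x y + hdist H y z"
    if "x \<in> carrier H" "y \<in> carrier H" "z \<in> carrier H" for x y z
    using that hnorm_minus_triangle by (simp add: hdist_def)
qed

end

section \<open>Convergence, closed subspaces and orthogonal projections\<close>

definition hconverges :: "'a inner_space \<Rightarrow> (nat \<Rightarrow> 'a) \<Rightarrow> 'a \<Rightarrow> bool" where
  "hconverges H s l \<longleftrightarrow>
     range s \<subseteq> carrier H \<and> l \<in> carrier H \<and> (\<lambda>n. hnorm H (s n \<ominus>\<^bsub>H\<^esub> l)) \<longlonglongrightarrow> 0"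

definition hCauchy :: "'a inner_space \<Rightarrow> (nat \<Rightarrow> 'a) \<Rightarrow> bool" where
  "hCauchy H s \<longleftrightarrow>
     range s \<subseteq> carrier H \<and> (\<forall>e>0. \<exists>K. \<forall>m\<ge>K. \<forall>n\<ge>K. hnorm H (s m \<ominus>\<^bsub>H\<^esub> s n) < e)"

context complex_inner_product_space
begin

lemma hconverges_iff_limitin:
  assumes "range s \<subseteq> carrier H"
  shows "hconverges H s l \<longleftrightarrow> limitin (htopology H) s l sequentially"
proof -
  have [simp]: "s n \<in> carrier H" for n using assms by auto
  have "(\<lambda>n. hdist H (s n) l) = (\<lambda>n. hnorm H (s n \<ominus> l))" if "l \<in> carrier H"
    using that by (simp add: hdist_def)
  then show ?thesis
    unfolding hconverges_def htopology_def
      Metric_space.limitin_metric_dist_null[OF Metric_space_hdist]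
    using assms by auto
qed

lemma hCauchy_iff_MCauchy: "hCauchy H s \<longleftrightarrow> Metric_space.MCauchy (carrier H) (hdist H) s"
proof (cases "range s \<subseteq> carrier H")
  case True
  then have "hdist H (s m) (s n) = hnorm H (s m \<ominus> s n)" for m n by (auto simp: hdist_def)
  then show ?thesis
    unfolding hCauchy_def Metric_space.MCauchy_def[OF Metric_space_hdist] by auto
next
  case False
  then show ?thesis
    unfolding hCauchy_def Metric_space.MCauchy_def[OF Metric_space_hdist] by simp
qed

lemma mcomplete_iff:
  "Metric_space.mcomplete (carrier H) (hdist H) \<longleftrightarrow> (\<forall>s. hCauchy H s \<longrightarrow> (\<exists>l. hconverges H s l))"
  unfolding Metric_space.mcomplete_def[OF Metric_space_hdist] htopology_def[symmetric]
    hCauchy_iff_MCauchy[symmetric]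
  by (metis hCauchy_def hconverges_iff_limitin)

lemma closedin_iff_sequentially:
  "closedin (htopology H) V \<longleftrightarrow>
     V \<subseteq> carrier H \<and> (\<forall>s l. range s \<subseteq> V \<longrightarrow> hconverges H s l \<longrightarrow> l \<in> V)"
proof -
  have "range s \<subseteq> V \<Longrightarrow> V \<subseteq> carrier H \<Longrightarrow> hconverges H s l \<longleftrightarrow> limitin (htopology H) s l sequentially"
    for s l using hconverges_iff_limitin[of s l] by blast
  then show ?thesis
    unfolding htopology_def
      Metric_space.metric_closedin_iff_sequentially_closed[OF Metric_space_hdist] by blast
qed

lemma uminus_eq_smult: "x \<in> carrier H \<Longrightarrow> \<ominus> x = (-1) \<odot> x"
  by (rule eq_if_cinner_eq) (simp_all add: cinner_linear)

lemma submodule_iff: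
  "submodule V (ring_of_type_algebra :: complex ring) H \<longleftrightarrow>
     V \<subseteq> carrier H \<and> \<zero> \<in> V \<and> (\<forall>x\<in>V. \<forall>y\<in>V. x \<oplus> y \<in> V) \<and> (\<forall>a. \<forall>x\<in>V. a \<odot> x \<in> V)"
  (is "?L \<longleftrightarrow> ?R")
proof
  assume L: ?L
  note E = submoduleE[OF L]
  obtain v where "v \<in> V" using E(2) by blast
  then have "\<zero> \<in> V" using E(1) E(4)[of 0 v] smult_l_null[of v] by auto
  then show ?R using E by auto
next
  assume R: ?R
  show ?L
  proof (rule submoduleI)
    show "\<ominus> v \<in> V" if "v \<in> V" for v
      using that R by (subst uminus_eq_smult) auto
  qed (use R in auto)
qed

lemma closed_subspace_iff:
  "closed_subspace H V \<longleftrightarrow>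
     V \<subseteq> carrier H \<and> \<zero> \<in> V \<and> (\<forall>x\<in>V. \<forall>y\<in>V. x \<oplus> y \<in> V) \<and> (\<forall>a. \<forall>x\<in>V. a \<odot> x \<in> V) \<and>
     (\<forall>s l. range s \<subseteq> V \<longrightarrow> hconverges H s l \<longrightarrow> l \<in> V)"
  unfolding closed_subspace_def submodule_iff closedin_iff_sequentially by blast

lemma closed_subspaceD:
  assumes "closed_subspace H V"
  shows "V \<subseteq> carrier H" "\<zero> \<in> V" "\<And>x y. x \<in> V \<Longrightarrow> y \<in> V \<Longrightarrow> x \<oplus> y \<in> V"
    "\<And>a x. x \<in> V \<Longrightarrow> a \<odot> x \<in> V" "\<And>x y. x \<in> V \<Longrightarrow> y \<in> V \<Longrightarrow> x \<ominus> y \<in> V"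
    "\<And>s l. range s \<subseteq> V \<Longrightarrow> hconverges H s l \<Longrightarrow> l \<in> V"
  using assms uminus_eq_smult unfolding closed_subspace_iff minus_eq by (auto simp: subset_iff)

lemma hconverges_cinner:
  assumes "hconverges H s l" "z \<in> carrier H"
  shows "(\<lambda>n. \<langle>s n, z\<rangle>) \<longlonglongrightarrow> \<langle>l, z\<rangle>"
proof -
  have sl: "s n \<in> carrier H" "l \<in> carrier H" for n using assms by (auto simp: hconverges_def)
  have "(\<lambda>n. hnorm H (s n \<ominus> l) * hnorm H z) \<longlonglongrightarrow> 0"
    using assms tendsto_mult_left_zero by (auto simp: hconverges_def)
  then have "(\<lambda>n. \<langle>s n, z\<rangle> - \<langle>l, z\<rangle>) \<longlonglongrightarrow> 0"
  proof (rule Lim_null_comparison[rotated])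
    show "\<forall>\<^sub>F n in sequentially. norm (\<langle>s n, z\<rangle> - \<langle>l, z\<rangle>) \<le> hnorm H (s n \<ominus> l) * hnorm H z"
      using sl assms Cauchy_Schwarz[of "s _ \<ominus> l" z] by (auto simp: cinner_minus_left)
  qed
  then show ?thesis by (simp add: LIM_zero_iff)
qed

lemma hconverges_dominated:
  assumes "range t \<subseteq> carrier H" "m \<in> carrier H" "g \<longlonglongrightarrow> 0"
    "\<And>n. hnorm H (t n \<ominus> m) \<le> g n"
  shows "hconverges H t m"
proof -
  have [simp]: "t n \<in> carrier H" for n using assms(1) by auto
  have "(\<lambda>n. hnorm H (t n \<ominus> m)) \<longlonglongrightarrow> 0"
    by (rule Lim_null_comparison[OF _ assms(3)]) (use assms(2,4) in simp)
  then show ?thesis using assms by (simp add: hconverges_def)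
qed

lemma hCauchy_dominated:
  assumes "hCauchy H s" "range t \<subseteq> carrier H" "k \<ge> 0"
    and le: "\<And>m n. hnorm H (t m \<ominus> t n) \<le> k * hnorm H (s m \<ominus> s n)"
  shows "hCauchy H t"
  unfolding hCauchy_def
proof (intro conjI allI impI)
  fix e :: real assume "e > 0"
  then have "e / (k + 1) > 0" using \<open>k \<ge> 0\<close> by simp
  then obtain K where K: "\<And>m n. m \<ge> K \<Longrightarrow> n \<ge> K \<Longrightarrow> hnorm H (s m \<ominus> s n) < e / (k + 1)"
    using assms(1) unfolding hCauchy_def by metis
  have s: "s n \<in> carrier H" for n using assms(1) by (auto simp: hCauchy_def)
  have "hnorm H (t m \<ominus> t n) < e" if "m \<ge> K" "n \<ge> K" for m n
  proof -
    have "k * hnorm H (s m \<ominus> s n) \<le> (k + 1) * hnorm H (s m \<ominus> s n)"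
      using s by (simp add: distrib_right)
    also have "\<dots> < e" using K[OF that] \<open>k \<ge> 0\<close> by (simp add: field_simps)
    finally show ?thesis by (rule le_less_trans[OF le])
  qed
  then show "\<exists>K. \<forall>m\<ge>K. \<forall>n\<ge>K. hnorm H (t m \<ominus> t n) < e" by blast
qed (rule assms)

lemma hconverges_imp_hCauchy:
  assumes "hconverges H s l"
  shows "hCauchy H s"
  unfolding hCauchy_def
proof (intro conjI allI impI)
  fix e :: real assume "e > 0"
  then have "e / 2 > 0" by simp
  then obtain K where K: "\<And>n. n \<ge> K \<Longrightarrow> \<bar>hnorm H (s n \<ominus> l)\<bar> < e / 2"
    using assms unfolding hconverges_def LIMSEQ_iff by (metis diff_zero real_norm_def)
  have sl: "s n \<in> carrier H" "l \<in> carrier H" for n using assms by (auto simp: hconverges_def)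
  have "hnorm H (s m \<ominus> s n) < e" if "m \<ge> K" "n \<ge> K" for m n
    using hnorm_minus_triangle[OF sl(1) sl(2) sl(1), of m n]
      hnorm_minus_commute[OF sl(2) sl(1), of n] K[OF that(1)] K[OF that(2)] by linarith
  then show "\<exists>K. \<forall>m\<ge>K. \<forall>n\<ge>K. hnorm H (s m \<ominus> s n) < e" by blast
qed (use assms in \<open>simp add: hconverges_def\<close>)

lemma parallelogram:
  assumes "x \<in> carrier H" "y \<in> carrier H"
  shows "(hnorm H (x \<oplus> y))\<^sup>2 + (hnorm H (x \<ominus> y))\<^sup>2 = 2 * (hnorm H x)\<^sup>2 + 2 * (hnorm H y)\<^sup>2"
  using assms by (simp add: hnorm_add_sq hnorm_minus_sq)

end

context complex_hilbert_space
begin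

lemma hCauchy_converges: "hCauchy H s \<Longrightarrow> \<exists>l. hconverges H s l"
  using complete mcomplete_iff by blast

text \<open>A minimising sequence for the distance to \<open>V\<close> is Cauchy by the
  parallelogram law, and its limit is a nearest point, from which no component along a vector
  of \<open>V\<close> can be removed.\<close>

theorem orthogonal_projection_exists:
  assumes V: "closed_subspace H V" and x [simp]: "x \<in> carrier H"
  shows "\<exists>p\<in>V. \<forall>v\<in>V. \<langle>x \<ominus> p, v\<rangle> = 0"
proof -
  note VD = closed_subspaceD[OF V]
  have VH: "v \<in> V \<Longrightarrow> v \<in> carrier H" for v using VD(1) by auto
  define D where "D = (\<lambda>v. (hnorm H (x \<ominus> v))\<^sup>2) ` V"
  define d where "d = Inf D"
  have bdd: "bdd_below D" unfolding D_def by (rule bdd_belowI[of _ 0]) auto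
  have d_le: "d \<le> (hnorm H (x \<ominus> v))\<^sup>2" if "v \<in> V" for v
    unfolding d_def by (rule cInf_lower[OF _ bdd]) (use that in \<open>auto simp: D_def\<close>)
  have d0: "d \<ge> 0"
    unfolding d_def by (rule cInf_greatest) (use VD(2) in \<open>auto simp: D_def\<close>)
  have "\<exists>v\<in>V. (hnorm H (x \<ominus> v))\<^sup>2 < d + 1 / real (Suc n)" for n
  proof -
    have "Inf D < d + 1 / real (Suc n)" by (simp add: d_def)
    moreover have "D \<noteq> {}" using VD(2) by (auto simp: D_def)
    ultimately obtain r where "r \<in> D" "r < d + 1 / real (Suc n)" using cInf_lessD by metis
    then show ?thesis by (auto simp: D_def)
  qed
  then obtain s where sV: "\<And>n. s n \<in> V"
    and s_lt: "\<And>n. (hnorm H (x \<ominus> s n))\<^sup>2 < d + 1 / real (Suc n)" by metis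
  have sH [simp]: "s n \<in> carrier H" for n using sV VH by blast
  have diff: "(hnorm H (s m \<ominus> s n))\<^sup>2 \<le> 2 / real (Suc m) + 2 / real (Suc n)" for m n
  proof -
    \<comment> \<open>The midpoint lies in \<open>V\<close>, so its squared distance from \<open>x\<close> is at least \<open>d\<close>.\<close>
    define p where "p = (1/2) \<odot> (s m \<oplus> s n)"
    have p: "p \<in> V" unfolding p_def by (intro VD(3,4) sV)
    have eqs: "(x \<ominus> s n) \<oplus> (x \<ominus> s m) = 2 \<odot> (x \<ominus> p)" "(x \<ominus> s n) \<ominus> (x \<ominus> s m) = s m \<ominus> s n"
      by (rule eq_if_cinner_eq; simp add: p_def cinner_linear algebra_simps)+
    have "(hnorm H (2 \<odot> (x \<ominus> p)))\<^sup>2 + (hnorm H (s m \<ominus> s n))\<^sup>2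
        = 2 * (hnorm H (x \<ominus> s n))\<^sup>2 + 2 * (hnorm H (x \<ominus> s m))\<^sup>2"
      using parallelogram[of "x \<ominus> s n" "x \<ominus> s m"] by (simp add: eqs)
    moreover have "(hnorm H (2 \<odot> (x \<ominus> p)))\<^sup>2 \<ge> 4 * d"
      using d_le[OF p] VH[OF p] by (simp add: hnorm_smult power_mult_distrib)
    ultimately show ?thesis using s_lt[of m] s_lt[of n] by simp
  qed
  have "hCauchy H s"
    unfolding hCauchy_def
  proof (intro conjI allI impI)
    fix e :: real assume e: "e > 0"
    obtain K where K: "4 / e\<^sup>2 < real (Suc K)"
      by (meson lessI less_trans of_nat_less_iff reals_Archimedean2)
    have "hnorm H (s m \<ominus> s n) < e" if "m \<ge> K" "n \<ge> K" for m n
    proof (rule power2_less_imp_less)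
      have "2 / real (Suc m) \<le> 2 / real (Suc K)" "2 / real (Suc n) \<le> 2 / real (Suc K)"
        using that by (simp_all add: frac_le)
      then have "(hnorm H (s m \<ominus> s n))\<^sup>2 \<le> 4 / real (Suc K)" using diff[of m n] by simp
      also have "\<dots> < e\<^sup>2" using K e by (simp add: field_simps)
      finally show "(hnorm H (s m \<ominus> s n))\<^sup>2 < e\<^sup>2" .
    qed (use e in simp)
    then show "\<exists>K. \<forall>m\<ge>K. \<forall>n\<ge>K. hnorm H (s m \<ominus> s n) < e" by blast
  qed auto
  then obtain p where lim: "hconverges H s p" using hCauchy_converges by blast
  have pV: "p \<in> V" using VD(6)[of s p] sV lim by blast
  then have p [simp]: "p \<in> carrier H" by (rule VH)
  have "hnorm H (x \<ominus> p) \<le> sqrt d"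
  proof (rule LIMSEQ_le_const)
    have "(\<lambda>n. sqrt (d + 1 / real (Suc n)) + hnorm H (s n \<ominus> p)) \<longlonglongrightarrow> sqrt (d + 0) + 0"
      using lim unfolding hconverges_def
      by (intro tendsto_intros LIMSEQ_Suc[OF lim_1_over_n]) auto
    then show "(\<lambda>n. sqrt (d + 1 / real (Suc n)) + hnorm H (s n \<ominus> p)) \<longlonglongrightarrow> sqrt d" by simp
    have "hnorm H (x \<ominus> s n) \<le> sqrt (d + 1 / real (Suc n))" for n
      by (rule real_le_rsqrt) (use s_lt[of n] in simp)
    then show "\<exists>N. \<forall>n\<ge>N. hnorm H (x \<ominus> p) \<le> sqrt (d + 1 / real (Suc n)) + hnorm H (s n \<ominus> p)"
      using hnorm_minus_triangle[OF x sH p] by (meson add_mono order.trans order_refl)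
  qed
  then have nearest: "(hnorm H (x \<ominus> p))\<^sup>2 \<le> d"
    using d0 power_mono[of "hnorm H (x \<ominus> p)" "sqrt d" 2] by simp
  have "\<langle>x \<ominus> p, v\<rangle> = 0" if v: "v \<in> V" for v
  proof (cases "v = \<zero>")
    case False
    have vH [simp]: "v \<in> carrier H" using v by (rule VH)
    define t where "t = \<langle>x \<ominus> p, v\<rangle> / complex_of_real ((hnorm H v)\<^sup>2)"
    have "(x \<ominus> p) \<ominus> t \<odot> v = x \<ominus> (p \<oplus> t \<odot> v)"
      by (rule eq_if_cinner_eq; simp add: cinner_linear algebra_simps)
    then have "d \<le> (hnorm H (x \<ominus> p))\<^sup>2 - (cmod \<langle>x \<ominus> p, v\<rangle>)\<^sup>2 / (hnorm H v)\<^sup>2"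
      using d_le[of "p \<oplus> t \<odot> v"] VD(3,4) v pV
        hnorm_remove_component_sq[of "x \<ominus> p" v] False by (simp add: t_def)
    then have "(cmod \<langle>x \<ominus> p, v\<rangle>)\<^sup>2 / (hnorm H v)\<^sup>2 \<le> 0" using nearest by linarith
    then show ?thesis using False by (simp add: divide_le_0_iff hnorm_eq_zero)
  qed simp
  then show ?thesis using pV by blast
qed

lemma trivial_orth_complement_imp_carrier:
  assumes "closed_subspace H V" "\<And>z. z \<in> carrier H \<Longrightarrow> \<forall>v\<in>V. \<langle>z, v\<rangle> = 0 \<Longrightarrow> z = \<zero>"
  shows "V = carrier H"
proof
  show "carrier H \<subseteq> V"
  proof
    fix x assume x: "x \<in> carrier H"
    obtain p where p: "p \<in> V" "\<forall>v\<in>V. \<langle>x \<ominus> p, v\<rangle> = 0"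
      using orthogonal_projection_exists[OF assms(1) x] by blast
    then have "p \<in> carrier H" using closed_subspaceD(1)[OF assms(1)] by auto
    then have "x = p" using assms(2)[of "x \<ominus> p"] p x by (simp add: minus_eq_zero_iff)
    then show "x \<in> V" using p by simp
  qed
qed (rule closed_subspaceD(1)[OF assms(1)])

text \<open>The representing vector of a non-zero functional is a multiple of any vector
  orthogonal to its kernel.\<close>

theorem Riesz_representation:
  assumes add: "\<And>x y. x \<in> carrier H \<Longrightarrow> y \<in> carrier H \<Longrightarrow> f (x \<oplus> y) = f x + f y"
    and smult: "\<And>a x. x \<in> carrier H \<Longrightarrow> f (a \<odot> x) = a * f x"
    and bounded: "\<And>x. x \<in> carrier H \<Longrightarrow> cmod (f x) \<le> k * hnorm H x"
  shows "\<exists>w\<in>carrier H. \<forall>x\<in>carrier H. f x = \<langle>x, w\<rangle>"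
proof -
  define V where "V = {x \<in> carrier H. f x = 0}"
  have f_minus: "f (x \<ominus> y) = f x - f y" if "x \<in> carrier H" "y \<in> carrier H" for x y
    using that add[of x "(-1) \<odot> y"] smult[of y "-1"] by (simp add: minus_eq uminus_eq_smult)
  have f0: "f \<zero> = 0" using smult[of \<zero> 0] by simp
  have closed: "l \<in> V" if s: "range s \<subseteq> V" and lim: "hconverges H s l" for s l
  proof -
    have sl: "s n \<in> carrier H" "f (s n) = 0" "l \<in> carrier H" for n
      using s lim by (auto simp: V_def hconverges_def)
    have "(\<lambda>n. k * hnorm H (s n \<ominus> l)) \<longlonglongrightarrow> k * 0"
      using lim unfolding hconverges_def by (intro tendsto_intros) auto
    moreover have "cmod (f l) \<le> k * hnorm H (s n \<ominus> l)" for n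
      using bounded[of "s n \<ominus> l"] sl by (simp add: f_minus)
    ultimately have "cmod (f l) \<le> k * 0" by (intro LIMSEQ_le_const) auto
    then show ?thesis using sl by (simp add: V_def)
  qed
  have V: "closed_subspace H V"
    unfolding closed_subspace_iff
  proof (intro conjI allI impI)
    show "l \<in> V" if "range s \<subseteq> V" "hconverges H s l" for s l
      using that by (rule closed)
  qed (simp_all add: V_def f0 add smult subset_iff)
  show ?thesis
  proof (cases "V = carrier H")
    case True
    then show ?thesis by (intro bexI[of _ \<zero>]) (auto simp: V_def)
  next
    case False
    then obtain u where u: "u \<in> carrier H" "u \<noteq> \<zero>" and orth: "\<And>v. v \<in> V \<Longrightarrow> \<langle>u, v\<rangle> = 0"
      using trivial_orth_complement_imp_carrier[OF V] by metis
    have nz: "\<langle>u, u\<rangle> \<noteq> 0" using u cinner_eq_zero by blast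
    obtain r where r: "\<langle>u, u\<rangle> = complex_of_real r" using cinner_self[OF u(1)] by blast
    have fu: "f u \<noteq> 0" using nz orth[of u] u by (auto simp: V_def)
    define w where "w = (cnj (f u) / \<langle>u, u\<rangle>) \<odot> u"
    have "f x = \<langle>x, w\<rangle>" if x: "x \<in> carrier H" for x
    proof -
      have "x \<ominus> (f x / f u) \<odot> u \<in> V" using x u fu by (simp add: V_def f_minus smult)
      then have "\<langle>u, x \<ominus> (f x / f u) \<odot> u\<rangle> = 0" by (rule orth)
      then have "\<langle>u, x\<rangle> = cnj (f x / f u) * \<langle>u, u\<rangle>" using x u by (simp add: cinner_linear)
      then have "\<langle>x, u\<rangle> = f x / f u * \<langle>u, u\<rangle>"
        unfolding cinner_commute[OF u(1) x] by (simp add: r)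
      then show ?thesis
        using x u(1) fu nz unfolding r by (simp add: w_def cinner_smult_right r)
    qed
    moreover have "w \<in> carrier H" using u by (simp add: w_def)
    ultimately show ?thesis by blast
  qed
qed

end

section \<open>Operators and their graphs\<close>

lemma opnorm_leI:
  assumes "k \<ge> 0" "\<And>x y. (x, y) \<in> T \<Longrightarrow> hnorm K y \<le> k * hnorm H x"
  shows "opnorm H K T \<le> ennreal k"
  unfolding opnorm_def
proof (rule SUP_least, clarify)
  fix x y assume xy: "(x, y) \<in> T" "hnorm H x \<le> 1"
  have "hnorm K y \<le> k * hnorm H x" using xy by (intro assms(2))
  also have "\<dots> \<le> k * 1" using xy \<open>k \<ge> 0\<close> by (intro mult_left_mono)
  finally show "ennreal (hnorm K y) \<le> ennreal k" by (simp add: ennreal_leI)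
qed

context complex_inner_product_space
begin

text \<open>The operator norm only tests the unit ball; homogeneity extends its bound to the whole domain.
  At a vector \<open>x\<close> of norm \<open>0\<close> all multiples of \<open>x\<close> lie in the unit ball, which forces the value to have
  norm \<open>0\<close> as well.\<close>

lemma opnorm_le_iff:
  assumes T: "T \<subseteq> carrier H \<times> carrier H"
    and smult: "\<And>a x y. (x, y) \<in> T \<Longrightarrow> (a \<odot> x, a \<odot> y) \<in> T" and "k \<ge> 0"
  shows "opnorm H H T \<le> ennreal k \<longleftrightarrow> (\<forall>(x, y)\<in>T. hnorm H y \<le> k * hnorm H x)"
proof
  assume L: "opnorm H H T \<le> ennreal k"
  have unit: "hnorm H y \<le> k" if "(x, y) \<in> T" "hnorm H x \<le> 1" for x y
  proof -
    have "ennreal (hnorm H y) \<le> opnorm H H T"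
      unfolding opnorm_def by (rule SUP_upper2[of "(x, y)"]) (use that in auto)
    also note L
    finally show ?thesis using \<open>k \<ge> 0\<close> by simp
  qed
  show "\<forall>(x, y)\<in>T. hnorm H y \<le> k * hnorm H x"
  proof clarify
    fix x y assume xy: "(x, y) \<in> T"
    then have H: "x \<in> carrier H" "y \<in> carrier H" using T by auto
    have scaled: "r * hnorm H y \<le> k" if "r \<ge> 0" "r * hnorm H x \<le> 1" for r :: real
      using unit[OF smult[OF xy, of "complex_of_real r"]] that H by (simp add: hnorm_smult)
    show "hnorm H y \<le> k * hnorm H x"
    proof (cases "hnorm H x = 0")
      case True
      have "hnorm H y = 0"
      proof (rule ccontr)
        assume "hnorm H y \<noteq> 0"
        then have "hnorm H y > 0" using H(2) hnorm_nonneg[of y] by linarith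
        then show False
          using scaled[of "(k + 1) / hnorm H y"] True \<open>k \<ge> 0\<close> by simp
      qed
      then show ?thesis using True by simp
    next
      case False
      then have "hnorm H x > 0" using H(1) hnorm_nonneg[of x] by linarith
      then show ?thesis using scaled[of "1 / hnorm H x"] by (simp add: field_simps)
    qed
  qed
next
  assume R: "\<forall>(x, y)\<in>T. hnorm H y \<le> k * hnorm H x"
  show "opnorm H H T \<le> ennreal k" by (rule opnorm_leI[OF \<open>k \<ge> 0\<close>]) (use R in blast)
qed

lemma linear_operatorD:
  assumes "linear_operator H H T"
  shows "T \<subseteq> carrier H \<times> carrier H" "single_valued T" "(\<zero>, \<zero>) \<in> T"
    "\<And>x y x' y'. (x, y) \<in> T \<Longrightarrow> (x', y') \<in> T \<Longrightarrow> (x \<oplus> x', y \<oplus> y') \<in> T"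
    "\<And>a x y. (x, y) \<in> T \<Longrightarrow> (a \<odot> x, a \<odot> y) \<in> T"
  using assms unfolding linear_operator_def by (blast, blast, blast, fast, fast)

end

definition op_apply :: "'a op_graph \<Rightarrow> 'a \<Rightarrow> 'a" where
  "op_apply T x = (THE y. (x, y) \<in> T)"

context complex_inner_product_space
begin

lemma bounded_ops_apply:
  assumes M: "M \<in> bounded_ops H H"
  shows "(x, y) \<in> M \<longleftrightarrow> x \<in> carrier H \<and> y = op_apply M x"
    and "x \<in> carrier H \<Longrightarrow> op_apply M x \<in> carrier H"
    and "x \<in> carrier H \<Longrightarrow> y \<in> carrier H \<Longrightarrow> op_apply M (x \<oplus> y) = op_apply M x \<oplus> op_apply M y"
    and "x \<in> carrier H \<Longrightarrow> op_apply M (a \<odot> x) = a \<odot> op_apply M x"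
    and "x \<in> carrier H \<Longrightarrow> hnorm H (op_apply M x) \<le> enn2real (opnorm H H M) * hnorm H x"
proof -
  have lin: "linear_operator H H M" and dom: "Domain M = carrier H" and fin: "opnorm H H M < \<infinity>"
    using M by (simp_all add: bounded_ops_def)
  note L = linear_operatorD[OF lin]
  have val: "op_apply M x = y" if "(x, y) \<in> M" for x y
    unfolding op_apply_def using that L(2) by (auto dest: single_valuedD)
  have mem: "(x, op_apply M x) \<in> M" if "x \<in> carrier H" for x
  proof -
    have "x \<in> Domain M" using that by (simp only: dom)
    then obtain y where y: "(x, y) \<in> M" by (rule DomainE)
    then show ?thesis by (simp add: val[OF y])
  qed
  show "(x, y) \<in> M \<longleftrightarrow> x \<in> carrier H \<and> y = op_apply M x"
    using L(1) val[of x y] mem[of x] by blast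
  show "op_apply M x \<in> carrier H" if "x \<in> carrier H" using mem[OF that] L(1) by blast
  show "op_apply M (x \<oplus> y) = op_apply M x \<oplus> op_apply M y" if "x \<in> carrier H" "y \<in> carrier H"
    by (rule val, rule L(4)) (use that mem in auto)
  show "op_apply M (a \<odot> x) = a \<odot> op_apply M x" if "x \<in> carrier H"
    by (rule val, rule L(5)) (use that mem in auto)
  have pos: "enn2real (opnorm H H M) \<ge> 0" by simp
  have "opnorm H H M \<le> ennreal (enn2real (opnorm H H M))" using fin by simp
  then show "hnorm H (op_apply M x) \<le> enn2real (opnorm H H M) * hnorm H x" if "x \<in> carrier H"
    using opnorm_le_iff[OF L(1,5) pos] mem[OF that] by fast
qed

end

text \<open>This is the identity \<open>A = - A\<^sup>*\<close>, phrased without negating values: the record of a subspace shares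
  addition, scalars and inner product with the ambient space, but its additive inverse is computed
  relative to its own carrier. Since \<open>- A\<^sup>*\<close> is always a closed linear relation, the condition
  also says that \<open>A\<close> is one.\<close>

definition skew_selfadjoint :: "'a inner_space \<Rightarrow> 'a op_graph \<Rightarrow> bool" where
  "skew_selfadjoint H A \<longleftrightarrow> A \<subseteq> carrier H \<times> carrier H \<and>
     (\<forall>z\<in>carrier H. \<forall>w\<in>carrier H.
        (z, w) \<in> A \<longleftrightarrow> (\<forall>(x, y)\<in>A. \<langle>y, z\<rangle>\<^bsub>H\<^esub> = - \<langle>x, w\<rangle>\<^bsub>H\<^esub>))"

context complex_inner_product_space
begin

lemma mem_B_op_iff: "(x, f) \<in> B_op H M A \<epsilon> \<longleftrightarrow>
    (\<exists>u y. (x, u) \<in> M \<and> (x, y) \<in> A \<and> f = u \<oplus> complex_of_real (1 / \<epsilon>) \<odot> y)"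
  by (auto simp: B_op_def op_add_def op_smult_def)

lemma skew_selfadjoint_if_eq_uminus_adjoint:
  assumes A: "A = op_uminus H (adjoint_op H H A)"
  shows "skew_selfadjoint H A"
proof -
  have sub: "A \<subseteq> carrier H \<times> carrier H"
    by (subst A) (auto simp: op_uminus_def adjoint_op_def)
  have "(z, w) \<in> A \<longleftrightarrow> (\<forall>(x, y)\<in>A. \<langle>y, z\<rangle> = - \<langle>x, w\<rangle>)"
    if z: "z \<in> carrier H" and w: "w \<in> carrier H" for z w
  proof -
    have "(z, w) \<in> A \<longleftrightarrow> (\<exists>v. w = \<ominus> v \<and> (z, v) \<in> adjoint_op H H A)"
      by (subst A) (auto simp: op_uminus_def)
    also have "\<dots> \<longleftrightarrow> (z, \<ominus> w) \<in> adjoint_op H H A"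
      using w by (auto simp: adjoint_op_def intro!: exI[of _ "\<ominus> w"])
    also have "\<dots> \<longleftrightarrow> (\<forall>(x, y)\<in>A. \<langle>y, z\<rangle> = - \<langle>x, w\<rangle>)"
      using z w sub by (fastforce simp: adjoint_op_def cinner_uminus_right)
    finally show ?thesis .
  qed
  then show ?thesis using sub by (simp add: skew_selfadjoint_def)
qed

lemma skew_selfadjointI:
  assumes "skew_selfadjoint H A" "z \<in> carrier H" "w \<in> carrier H"
    "\<And>x y. (x, y) \<in> A \<Longrightarrow> \<langle>y, z\<rangle> = - \<langle>x, w\<rangle>"
  shows "(z, w) \<in> A"
  using assms unfolding skew_selfadjoint_def by blast

lemma skew_selfadjointD:
  assumes A: "skew_selfadjoint H A"
  shows "(x, y) \<in> A \<Longrightarrow> x \<in> carrier H" "(x, y) \<in> A \<Longrightarrow> y \<in> carrier H"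
    "(x, y) \<in> A \<Longrightarrow> (x', y') \<in> A \<Longrightarrow> \<langle>y, x'\<rangle> = - \<langle>x, y'\<rangle>"
    "(\<zero>, \<zero>) \<in> A"
    "(x, y) \<in> A \<Longrightarrow> (x', y') \<in> A \<Longrightarrow> (x \<oplus> x', y \<oplus> y') \<in> A"
    "(x, y) \<in> A \<Longrightarrow> (a \<odot> x, a \<odot> y) \<in> A"
    "(x, y) \<in> A \<Longrightarrow> Re \<langle>y, x\<rangle> = 0"
proof -
  show carr: "x \<in> carrier H" "y \<in> carrier H" if "(x, y) \<in> A" for x y
    using that A unfolding skew_selfadjoint_def by auto
  show skew: "\<langle>y, x'\<rangle> = - \<langle>x, y'\<rangle>" if "(x, y) \<in> A" "(x', y') \<in> A" for x y x' y'
    using that A carr[OF that(2)] unfolding skew_selfadjoint_def by fast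
  show "(\<zero>, \<zero>) \<in> A" by (rule skew_selfadjointI[OF A]) (simp_all add: carr)
  show "(x \<oplus> x', y \<oplus> y') \<in> A" if "(x, y) \<in> A" "(x', y') \<in> A"
    by (rule skew_selfadjointI[OF A])
      (use carr[OF that(1)] carr[OF that(2)] in
        \<open>simp_all add: carr cinner_linear skew[OF _ that(1)] skew[OF _ that(2)]\<close>)
  show "(a \<odot> x, a \<odot> y) \<in> A" if "(x, y) \<in> A"
    by (rule skew_selfadjointI[OF A])
      (use carr[OF that(1)] in \<open>simp_all add: carr cinner_linear skew[OF _ that(1)]\<close>)
  show "Re \<langle>y, x\<rangle> = 0" if "(x, y) \<in> A"
    using skew[OF that that] unfolding cinner_commute[OF carr[OF that]]
    by (simp add: complex_eq_iff)
qed

end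

section \<open>Accretive perturbations of skew-selfadjoint operators\<close>

context complex_hilbert_space
begin

lemma adjoint_exists:
  assumes M: "M \<in> bounded_ops H H" and z: "z \<in> carrier H"
  shows "\<exists>w\<in>carrier H. \<forall>x\<in>carrier H. \<langle>op_apply M x, z\<rangle> = \<langle>x, w\<rangle>"
proof -
  define m where "m = op_apply M"
  note m = bounded_ops_apply[OF M, folded m_def]
  show ?thesis
    unfolding m_def[symmetric]
  proof (rule Riesz_representation)
    fix x assume x: "x \<in> carrier H"
    define k where "k = enn2real (opnorm H H M)"
    have "cmod \<langle>m x, z\<rangle> \<le> hnorm H (m x) * hnorm H z" using m(2) x z by (intro Cauchy_Schwarz)
    also have "\<dots> \<le> (k * hnorm H x) * hnorm H z"
      using m(5) x z by (intro mult_right_mono) (simp_all add: k_def)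
    finally show "cmod \<langle>m x, z\<rangle> \<le> (enn2real (opnorm H H M) * hnorm H z) * hnorm H x"
      by (simp add: mult_ac k_def)
  qed (use m(2-4) z in \<open>simp_all add: cinner_linear\<close>)
qed

text \<open>The hypothesis on \<open>re_op H M\<close> speaks of the vectors in the domain of \<open>M\<^sup>*\<close> only; by the Riesz
  representation these are all vectors.\<close>

lemma accretive_if_re_op_ge:
  assumes M: "M \<in> bounded_ops H H" and ge: "op_ge H (re_op H M) c" and xy: "(x, y) \<in> M"
  shows "c * (hnorm H x)\<^sup>2 \<le> Re \<langle>y, x\<rangle>"
proof -
  have "linear_operator H H M" using M by (simp add: bounded_ops_def)
  then have H: "x \<in> carrier H" "y \<in> carrier H" using linear_operatorD(1) xy by blast+
  obtain w where wH: "w \<in> carrier H"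
    and adj: "\<forall>v\<in>carrier H. \<langle>op_apply M v, x\<rangle> = \<langle>v, w\<rangle>"
    using adjoint_exists[OF M H(1)] by (rule bexE)
  have w: "(x, w) \<in> adjoint_op H H M"
    using H(1) wH adj unfolding adjoint_op_def by (auto simp: bounded_ops_apply(1)[OF M])
  have "\<langle>y, x\<rangle> = \<langle>x, w\<rangle>" using xy adj H(1) by (simp add: bounded_ops_apply(1)[OF M])
  then have "\<langle>w, x\<rangle> = cnj \<langle>y, x\<rangle>" using cinner_commute[OF H(1) wH] by simp
  moreover have "(x, (1/2) \<odot> (y \<oplus> w)) \<in> re_op H M"
    using xy w by (auto simp: re_op_def op_smult_def op_add_def)
  then have "c * (hnorm H x)\<^sup>2 \<le> Re \<langle>(1/2) \<odot> (y \<oplus> w), x\<rangle>"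
    using ge unfolding op_ge_def by blast
  ultimately show ?thesis using H wH by (simp add: cinner_linear)
qed

text \<open>The skew part drops out of \<open>Re \<langle>f, x\<rangle>\<close>, so the lower bound is the one of \<open>M\<close> and does
  not depend on \<open>\<epsilon>\<close>.\<close>

lemma B_op_coercive:
  assumes M: "M \<subseteq> carrier H \<times> carrier H" and A: "skew_selfadjoint H A"
    and accretive: "\<And>x y. (x, y) \<in> M \<Longrightarrow> c * (hnorm H x)\<^sup>2 \<le> Re \<langle>y, x\<rangle>"
    and xf: "(x, f) \<in> B_op H M A \<epsilon>"
  shows "c * hnorm H x \<le> hnorm H f"
proof -
  obtain u y where u: "(x, u) \<in> M" and y: "(x, y) \<in> A"
    and f: "f = u \<oplus> complex_of_real (1 / \<epsilon>) \<odot> y"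
    using xf by (auto simp: mem_B_op_iff)
  have H: "x \<in> carrier H" "u \<in> carrier H" "y \<in> carrier H"
    using u M skew_selfadjointD(1,2)[OF A] y by auto
  have "c * (hnorm H x)\<^sup>2 \<le> Re \<langle>f, x\<rangle>"
    using accretive[OF u] skew_selfadjointD(7)[OF A y] H by (simp add: f cinner_linear)
  also have "\<dots> \<le> hnorm H f * hnorm H x" using H by (intro Re_cinner_le) (simp_all add: f)
  finally have "c * hnorm H x * hnorm H x \<le> hnorm H f * hnorm H x"
    by (simp add: power2_eq_square mult.assoc)
  moreover have "hnorm H x > 0 \<or> hnorm H x = 0" using hnorm_nonneg[OF H(1)] by linarith
  moreover have "hnorm H f \<ge> 0" using H by (simp add: f)
  ultimately show ?thesis by auto
qed

text \<open>Coercivity makes the inverse single-valued and bounded and, \<open>A\<close> being closed, makes the range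
  closed. A vector \<open>z\<close> orthogonal to the range satisfies \<open>A\<^sup>* z = - \<epsilon> M\<^sup>* z\<close>. Since \<open>A = - A\<^sup>*\<close>, it lies in
  the domain of \<open>A\<close>, and testing the orthogonality against the image of \<open>z\<close> itself gives \<open>z = 0\<close> by
  coercivity.\<close>

theorem B_op_inverse_bounded:
  assumes M: "M \<in> bounded_ops H H" and A: "skew_selfadjoint H A" and "c > 0" "\<epsilon> \<noteq> 0"
    and accretive: "\<And>x y. (x, y) \<in> M \<Longrightarrow> c * (hnorm H x)\<^sup>2 \<le> Re \<langle>y, x\<rangle>"
  shows "(B_op H M A \<epsilon>)\<inverse> \<in> bounded_ops H H"
proof -
  define m where "m = op_apply M"
  note m = bounded_ops_apply(1)[OF M, folded m_def]
    and mH [simp] = bounded_ops_apply(2)[OF M, folded m_def]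
    and m_add = bounded_ops_apply(3)[OF M, folded m_def]
    and m_smult = bounded_ops_apply(4)[OF M, folded m_def]
  note adj = adjoint_exists[OF M, folded m_def]
  note AD = skew_selfadjointD[OF A]
  define e where "e = complex_of_real \<epsilon>"
  have e: "e \<noteq> 0" "cnj e = e" using \<open>\<epsilon> \<noteq> 0\<close> by (simp_all add: e_def)
  define B where "B = B_op H M A \<epsilon>"
  have mem: "(x, f) \<in> B \<longleftrightarrow> (\<exists>y. (x, y) \<in> A \<and> f = m x \<oplus> (1 / e) \<odot> y)" for x f
    using AD(1) by (auto simp: B_def mem_B_op_iff m e_def)
  have BH: "x \<in> carrier H" "f \<in> carrier H" if "(x, f) \<in> B" for x f
    using that AD(1,2) by (auto simp: mem)
  have coercive: "c * hnorm H x \<le> hnorm H f" if "(x, f) \<in> B" for x f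
    by (rule B_op_coercive[OF _ A accretive that[unfolded B_def]]) (auto simp: m)
  have B_zero: "(\<zero>, \<zero>) \<in> B"
  proof -
    have "m \<zero> = m (0 \<odot> \<zero>)" by simp
    also have "\<dots> = \<zero>" unfolding m_smult[OF zero_closed] by simp
    finally show ?thesis unfolding mem using AD(4) by (intro exI[of _ \<zero>]) simp
  qed
  have B_add: "(x \<oplus> x', f \<oplus> f') \<in> B" if h: "(x, f) \<in> B" "(x', f') \<in> B" for x f x' f'
  proof -
    obtain y y' where y: "(x, y) \<in> A" "f = m x \<oplus> (1 / e) \<odot> y"
      "(x', y') \<in> A" "f' = m x' \<oplus> (1 / e) \<odot> y'" using h unfolding mem by blast
    have H [simp]: "x \<in> carrier H" "y \<in> carrier H" "x' \<in> carrier H" "y' \<in> carrier H"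
      using y AD(1,2) by auto
    have "f \<oplus> f' = m (x \<oplus> x') \<oplus> (1 / e) \<odot> (y \<oplus> y')"
      by (rule eq_if_cinner_eq) (simp_all add: y m_add cinner_linear algebra_simps)
    then show ?thesis using AD(5)[OF y(1,3)] unfolding mem by blast
  qed
  have B_smult: "(a \<odot> x, a \<odot> f) \<in> B" if h: "(x, f) \<in> B" for a x f
  proof -
    obtain y where y: "(x, y) \<in> A" "f = m x \<oplus> (1 / e) \<odot> y" using h unfolding mem by blast
    have H [simp]: "x \<in> carrier H" "y \<in> carrier H" using y AD(1,2) by auto
    have "a \<odot> f = m (a \<odot> x) \<oplus> (1 / e) \<odot> (a \<odot> y)"
      by (rule eq_if_cinner_eq) (simp_all add: y m_smult cinner_linear algebra_simps)
    then show ?thesis using AD(6)[OF y(1)] unfolding mem by blast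
  qed
  have B_minus: "(x \<ominus> x', f \<ominus> f') \<in> B" if "(x, f) \<in> B" "(x', f') \<in> B" for x f x' f'
    using B_add[OF that(1) B_smult[OF that(2), of "-1"]] BH[OF that(1)] BH[OF that(2)]
    by (simp add: minus_eq uminus_eq_smult)
  have "l \<in> Range B" if t: "range t \<subseteq> Range B" and lim: "hconverges H t l" for t l
  proof -
    have "\<exists>x. (x, t n) \<in> B" for n using t by blast
    then obtain s where s: "\<And>n. (s n, t n) \<in> B" by metis
    then have "\<exists>y. (s n, y) \<in> A \<and> t n = m (s n) \<oplus> (1 / e) \<odot> y" for n unfolding mem by blast
    then obtain y where y: "\<And>n. (s n, y n) \<in> A" and ty: "\<And>n. t n = m (s n) \<oplus> (1 / e) \<odot> y n"
      by metis
    have H [simp]: "s n \<in> carrier H" "t n \<in> carrier H" "y n \<in> carrier H" "l \<in> carrier H" for n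
      using BH[OF s[of n]] AD(2)[OF y[of n]] lim by (simp_all add: hconverges_def)
    have "hCauchy H s"
    proof (rule hCauchy_dominated)
      show "hCauchy H t" by (rule hconverges_imp_hCauchy[OF lim])
      show "hnorm H (s i \<ominus> s j) \<le> (1 / c) * hnorm H (t i \<ominus> t j)" for i j
        using coercive[OF B_minus[OF s s], of i j] \<open>c > 0\<close> by (simp add: field_simps)
    qed (use \<open>c > 0\<close> in auto)
    then obtain p where p: "hconverges H s p" using hCauchy_converges by blast
    then have pH [simp]: "p \<in> carrier H" by (simp add: hconverges_def)
    define q where "q = e \<odot> (l \<ominus> m p)"
    have qH [simp]: "q \<in> carrier H" by (simp add: q_def)
    \<comment> \<open>The operator \<open>M\<close> is moved to the other side by its adjoint, so that weak limits suffice.\<close>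
    have "(p, q) \<in> A"
    proof (rule skew_selfadjointI[OF A])
      fix x z assume xz: "(x, z) \<in> A"
      then have [simp]: "x \<in> carrier H" "z \<in> carrier H" using AD(1,2) by auto
      obtain w where w: "w \<in> carrier H" and mw: "\<forall>v\<in>carrier H. \<langle>m v, x\<rangle> = \<langle>v, w\<rangle>"
        using adj[OF \<open>x \<in> carrier H\<close>] by (rule bexE)
      have "\<langle>s n, z\<rangle> = - (e * (\<langle>t n, x\<rangle> - \<langle>s n, w\<rangle>))" for n
        using AD(3)[OF y xz, of n] e w by (simp add: ty cinner_linear mw)
      moreover have "(\<lambda>n. - (e * (\<langle>t n, x\<rangle> - \<langle>s n, w\<rangle>))) \<longlonglongrightarrow> - (e * (\<langle>l, x\<rangle> - \<langle>p, w\<rangle>))"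
        by (intro tendsto_intros hconverges_cinner[OF lim] hconverges_cinner[OF p] w) simp
      ultimately have "\<langle>p, z\<rangle> = - (e * (\<langle>l, x\<rangle> - \<langle>p, w\<rangle>))"
        using LIMSEQ_unique[OF hconverges_cinner[OF p \<open>z \<in> carrier H\<close>]] by simp
      then have "\<langle>p, z\<rangle> = - \<langle>q, x\<rangle>" by (simp add: q_def cinner_linear mw)
      then show "\<langle>z, p\<rangle> = - \<langle>x, q\<rangle>"
        using cinner_commute[of p z] cinner_commute[of q x] by simp
    qed simp_all
    moreover have "l = m p \<oplus> (1 / e) \<odot> q"
      by (rule eq_if_cinner_eq) (use e in \<open>simp_all add: q_def cinner_linear\<close>)
    ultimately have "(p, l) \<in> B" unfolding mem by blast
    then show ?thesis by blast
  qed
  moreover have "Range B \<subseteq> carrier H" using BH by blast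
  ultimately have closed: "closed_subspace H (Range B)"
    unfolding closed_subspace_iff using B_zero B_add B_smult by (meson Range.cases Range.intros)
  have range: "Range B = carrier H"
  proof (rule trivial_orth_complement_imp_carrier[OF closed])
    fix z assume z [simp]: "z \<in> carrier H" and orth: "\<forall>f\<in>Range B. \<langle>z, f\<rangle> = 0"
    obtain w where w [simp]: "w \<in> carrier H" and mw: "\<forall>v\<in>carrier H. \<langle>m v, z\<rangle> = \<langle>v, w\<rangle>"
      using adj[OF z] by (rule bexE)
    have zA: "(z, e \<odot> w) \<in> A"
    proof (rule skew_selfadjointI[OF A])
      fix x y assume xy: "(x, y) \<in> A"
      then have [simp]: "x \<in> carrier H" "y \<in> carrier H" using AD(1,2) by auto
      have "(x, m x \<oplus> (1 / e) \<odot> y) \<in> B" using xy unfolding mem by blast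
      then have "\<langle>z, m x \<oplus> (1 / e) \<odot> y\<rangle> = 0" using orth by blast
      then have "\<langle>m x \<oplus> (1 / e) \<odot> y, z\<rangle> = 0"
        using cinner_commute[of z "m x \<oplus> (1 / e) \<odot> y"] by simp
      then have "\<langle>x, w\<rangle> + \<langle>y, z\<rangle> / e = 0" by (simp add: cinner_linear mw)
      then have "\<langle>y, z\<rangle> / e = - \<langle>x, w\<rangle>" by (simp only: add_eq_0_iff)
      then have "\<langle>y, z\<rangle> = - \<langle>x, w\<rangle> * e" by (rule iffD1[OF nonzero_divide_eq_eq[OF e(1)]])
      then show "\<langle>y, z\<rangle> = - \<langle>x, e \<odot> w\<rangle>" by (simp add: cinner_smult_right e(2))
    qed simp_all
    then have zB: "(z, m z \<oplus> (1 / e) \<odot> (e \<odot> w)) \<in> B" unfolding mem by blast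
    then have "\<langle>z, m z \<oplus> (1 / e) \<odot> (e \<odot> w)\<rangle> = 0" using orth by blast
    then have "\<langle>z, m z\<rangle> + \<langle>z, (1 / e) \<odot> (e \<odot> w)\<rangle> = 0" by (simp add: cinner_add_right)
    moreover have "Re \<langle>z, (1 / e) \<odot> (e \<odot> w)\<rangle> = 0"
      using AD(7)[OF AD(6)[OF zA, of "1"]] AD(7)[OF zA] cinner_commute[of "e \<odot> w" z]
      by (simp add: cinner_smult_right e_def)
    ultimately have "Re \<langle>z, m z\<rangle> = 0" by (simp add: complex_eq_iff)
    then have "c * (hnorm H z)\<^sup>2 \<le> 0"
      using accretive[of z "m z"] cinner_commute[of z "m z"] by (simp add: m)
    then show "z = \<zero>" using \<open>c > 0\<close> by (simp add: mult_le_0_iff hnorm_eq_zero)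
  qed
  have lin: "linear_operator H H (B\<inverse>)"
    unfolding linear_operator_def
  proof (intro conjI)
    show "B\<inverse> \<subseteq> carrier H \<times> carrier H" using BH by auto
    show "single_valued (B\<inverse>)"
    proof (rule single_valuedI)
      fix f x x' assume "(f, x) \<in> B\<inverse>" "(f, x') \<in> B\<inverse>"
      then have x: "(x, f) \<in> B" and x': "(x', f) \<in> B" by auto
      have H: "x \<in> carrier H" "x' \<in> carrier H" "f \<in> carrier H" using BH[OF x] BH[OF x'] by auto
      have "c * hnorm H (x \<ominus> x') \<le> hnorm H (f \<ominus> f)" by (rule coercive[OF B_minus[OF x x']])
      also have "f \<ominus> f = \<zero>" using H by (simp add: minus_eq_zero_iff)
      finally have "hnorm H (x \<ominus> x') \<le> 0" using \<open>c > 0\<close> by (simp add: mult_le_0_iff)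
      moreover have "hnorm H (x \<ominus> x') \<ge> 0" using H by simp
      ultimately have "hnorm H (x \<ominus> x') = 0" by linarith
      then show "x = x'" using H by (simp add: hnorm_eq_zero minus_eq_zero_iff)
    qed
  qed (use B_zero B_add B_smult in auto)
  have "opnorm H H (B\<inverse>) \<le> ennreal (1 / c)"
    using opnorm_le_iff[OF linear_operatorD(1,5)[OF lin], of "1 / c"] coercive \<open>c > 0\<close>
    by (auto simp: field_simps)
  then have "opnorm H H (B\<inverse>) < \<infinity>" by (rule order_le_less_trans) simp
  then show ?thesis using lin range by (simp add: bounded_ops_def B_def)
qed

end

section \<open>Subspaces and compressions\<close>

lemma subsp_simps [simp]:
  "carrier (subsp H N) = N"
  "x \<oplus>\<^bsub>subsp H N\<^esub> y = x \<oplus>\<^bsub>H\<^esub> y"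
  "\<zero>\<^bsub>subsp H N\<^esub> = \<zero>\<^bsub>H\<^esub>"
  "a \<odot>\<^bsub>subsp H N\<^esub> x = a \<odot>\<^bsub>H\<^esub> x"
  "\<langle>x, y\<rangle>\<^bsub>subsp H N\<^esub> = \<langle>x, y\<rangle>\<^bsub>H\<^esub>"
  "hnorm (subsp H N) x = hnorm H x"
  by (simp_all add: subsp_def hnorm_def)

lemma opnorm_subsp [simp]: "opnorm (subsp H N) (subsp H N) T = opnorm H H T"
  by (simp add: opnorm_def)

context complex_inner_product_space
begin

lemma bounded_opsI:
  assumes mem: "\<And>x y. (x, y) \<in> T \<longleftrightarrow> x \<in> carrier H \<and> y = g x"
    and gH: "\<And>x. x \<in> carrier H \<Longrightarrow> g x \<in> carrier H"
    and add: "\<And>x y. x \<in> carrier H \<Longrightarrow> y \<in> carrier H \<Longrightarrow> g (x \<oplus> y) = g x \<oplus> g y"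
    and smult: "\<And>a x. x \<in> carrier H \<Longrightarrow> g (a \<odot> x) = a \<odot> g x"
    and bound: "\<And>x. x \<in> carrier H \<Longrightarrow> hnorm H (g x) \<le> k * hnorm H x" and "k \<ge> 0"
  shows "T \<in> bounded_ops H H"
proof -
  have g0: "g \<zero> = \<zero>" using smult[of \<zero> 0] gH[of \<zero>] by simp
  have "linear_operator H H T"
    unfolding linear_operator_def
  proof (intro conjI)
    show "T \<subseteq> carrier H \<times> carrier H" by (auto simp: mem gH)
    show "single_valued T" by (rule single_valuedI) (simp add: mem)
    show "(\<zero>, \<zero>) \<in> T" by (simp add: mem g0)
    show "\<forall>(x, y)\<in>T. \<forall>(x', y')\<in>T. (x \<oplus> x', y \<oplus> y') \<in> T" by (auto simp: mem add)
    show "\<forall>a. \<forall>(x, y)\<in>T. (a \<odot> x, a \<odot> y) \<in> T" by (auto simp: mem smult)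
  qed
  moreover have "Domain T = carrier H" by (auto simp: mem)
  moreover have "opnorm H H T \<le> ennreal k"
    by (rule opnorm_leI[OF \<open>k \<ge> 0\<close>]) (simp add: mem bound)
  then have "opnorm H H T < \<infinity>" by (rule order_le_less_trans) simp
  ultimately show ?thesis by (simp add: bounded_ops_def)
qed

lemma B_op_bounded:
  assumes M: "M \<in> bounded_ops H H" and A: "A \<in> bounded_ops H H"
  shows "B_op H M A \<epsilon> \<in> bounded_ops H H"
proof -
  define m a e where "m = op_apply M" and "a = op_apply A" and "e = complex_of_real (1 / \<epsilon>)"
  note m = bounded_ops_apply[OF M, folded m_def] and a = bounded_ops_apply[OF A, folded a_def]
  define k l where "k = enn2real (opnorm H H M)" and "l = enn2real (opnorm H H A)"
  show ?thesis
  proof (rule bounded_opsI)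
    show "(x, y) \<in> B_op H M A \<epsilon> \<longleftrightarrow> x \<in> carrier H \<and> y = m x \<oplus> e \<odot> a x" for x y
      unfolding mem_B_op_iff m(1) a(1) e_def by blast
    show "m x \<oplus> e \<odot> a x \<in> carrier H" if "x \<in> carrier H" for x
      using that by (simp add: m(2) a(2))
    show "m (x \<oplus> y) \<oplus> e \<odot> a (x \<oplus> y) = (m x \<oplus> e \<odot> a x) \<oplus> (m y \<oplus> e \<odot> a y)"
      if "x \<in> carrier H" "y \<in> carrier H" for x y
      by (rule eq_if_cinner_eq)
        (use that in \<open>simp_all add: m(2,3) a(2,3) cinner_linear algebra_simps\<close>)
    show "m (b \<odot> x) \<oplus> e \<odot> a (b \<odot> x) = b \<odot> (m x \<oplus> e \<odot> a x)" if "x \<in> carrier H" for b x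
      by (rule eq_if_cinner_eq)
        (use that in \<open>simp_all add: m(2,4) a(2,4) cinner_linear algebra_simps\<close>)
    show "k + cmod e * l \<ge> 0" by (simp add: k_def l_def)
    show "hnorm H (m x \<oplus> e \<odot> a x) \<le> (k + cmod e * l) * hnorm H x" if x: "x \<in> carrier H" for x
    proof -
      have "hnorm H (m x \<oplus> e \<odot> a x) \<le> hnorm H (m x) + cmod e * hnorm H (a x)"
        using hnorm_triangle[of "m x" "e \<odot> a x"] m(2)[OF x] a(2)[OF x] by (simp add: hnorm_smult)
      also have "\<dots> \<le> k * hnorm H x + cmod e * (l * hnorm H x)"
        unfolding k_def l_def by (intro add_mono mult_left_mono m(5) a(5) x) simp
      finally show ?thesis by (simp add: algebra_simps)
    qed
  qed
qed

lemma complex_inner_product_space_subsp: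
  assumes "closed_subspace H N"
  shows "complex_inner_product_space (subsp H N)"
proof -
  have sub: "N \<subseteq> carrier H" and "submodule N (ring_of_type_algebra :: complex ring) H"
    using assms closed_subspaceD(1) by (auto simp: closed_subspace_def)
  then have "module (ring_of_type_algebra :: complex ring) (subsp H N)"
    unfolding subsp_def by (intro submodule.submodule_is_module module_axioms)
  then show ?thesis
  proof (intro complex_inner_product_space.intro complex_inner_product_space_axioms.intro)
    fix x y z a assume "x \<in> carrier (subsp H N)" "y \<in> carrier (subsp H N)" "z \<in> carrier (subsp H N)"
    then show "\<langle>x \<oplus>\<^bsub>subsp H N\<^esub> y, z\<rangle>\<^bsub>subsp H N\<^esub> = \<langle>x, z\<rangle>\<^bsub>subsp H N\<^esub> + \<langle>y, z\<rangle>\<^bsub>subsp H N\<^esub>"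
      using sub by (simp add: cinner_add_left subset_iff)
  next
    fix x y a assume "x \<in> carrier (subsp H N)" "y \<in> carrier (subsp H N)"
    then have "x \<in> carrier H" "y \<in> carrier H" using sub by auto
    then show "\<langle>a \<odot>\<^bsub>subsp H N\<^esub> x, y\<rangle>\<^bsub>subsp H N\<^esub> = a * \<langle>x, y\<rangle>\<^bsub>subsp H N\<^esub>"
      and "\<langle>y, x\<rangle>\<^bsub>subsp H N\<^esub> = cnj \<langle>x, y\<rangle>\<^bsub>subsp H N\<^esub>"
      using cinner_commute[of x y] by (simp_all add: cinner_smult_left)
  next
    fix x assume "x \<in> carrier (subsp H N)"
    then have x: "x \<in> carrier H" using sub by auto
    then show "0 \<le> Re \<langle>x, x\<rangle>\<^bsub>subsp H N\<^esub>" by (simp add: cinner_ge_zero)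
    assume "\<langle>x, x\<rangle>\<^bsub>subsp H N\<^esub> = 0"
    then show "x = \<zero>\<^bsub>subsp H N\<^esub>" using x cinner_eq_zero by simp
  qed
qed

text \<open>Differences have to be compared because the norm distance, and with it convergence in a
  subspace, is defined by them.\<close>

lemma minus_subsp:
  assumes "closed_subspace H N" "x \<in> N" "y \<in> N"
  shows "x \<ominus>\<^bsub>subsp H N\<^esub> y = x \<ominus> y"
proof -
  interpret S: complex_inner_product_space "subsp H N"
    by (rule complex_inner_product_space_subsp[OF assms(1)])
  have "y \<in> carrier H" using closed_subspaceD(1)[OF assms(1)] assms by auto
  then show ?thesis
    using S.uminus_eq_smult[of y] assms by (simp add: a_minus_def uminus_eq_smult)
qed

lemma closed_subspace_orth_complement:
  assumes "N \<subseteq> carrier H"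
  shows "closed_subspace H (orth_complement H N)"
  unfolding closed_subspace_iff
proof (intro conjI allI impI)
  fix s l assume s: "range s \<subseteq> orth_complement H N" and lim: "hconverges H s l"
  have "\<langle>l, y\<rangle> = 0" if "y \<in> N" for y
  proof (rule LIMSEQ_unique)
    show "(\<lambda>n. \<langle>s n, y\<rangle>) \<longlonglongrightarrow> \<langle>l, y\<rangle>" using that assms by (intro hconverges_cinner[OF lim]) auto
    have "\<langle>s n, y\<rangle> = 0" for n using s that by (auto simp: orth_complement_def)
    then show "(\<lambda>n. \<langle>s n, y\<rangle>) \<longlonglongrightarrow> 0" by simp
  qed
  then show "l \<in> orth_complement H N"
    using lim by (simp add: orth_complement_def hconverges_def)
qed (use assms in \<open>auto simp: orth_complement_def cinner_linear subset_iff\<close>)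

end

context complex_hilbert_space
begin

lemma complex_hilbert_space_subsp:
  assumes N: "closed_subspace H N"
  shows "complex_hilbert_space (subsp H N)"
proof -
  interpret S: complex_inner_product_space "subsp H N"
    by (rule complex_inner_product_space_subsp[OF N])
  have "\<exists>l. hconverges (subsp H N) s l" if "hCauchy (subsp H N) s" for s
  proof -
    have sN: "s n \<in> N" for n using that by (auto simp: hCauchy_def)
    then have "hCauchy H s"
      using that closed_subspaceD(1)[OF N] by (auto simp: hCauchy_def minus_subsp[OF N])
    then obtain l where l: "hconverges H s l" using hCauchy_converges by blast
    moreover have "l \<in> N" by (rule closed_subspaceD(6)[OF N _ l]) (use sN in auto)
    ultimately have "hconverges (subsp H N) s l"
      using sN by (auto simp: hconverges_def minus_subsp[OF N])
    then show ?thesis by blast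
  qed
  then show ?thesis
    unfolding complex_hilbert_space_def complex_hilbert_space_axioms_def S.mcomplete_iff
    using S.complex_inner_product_space_axioms by blast
qed

text \<open>By the projection theorem, the adjoint of the embedding of a closed subspace is
  the everywhere defined orthogonal projection.\<close>

lemma emb_adj_apply:
  assumes N: "closed_subspace H N"
  defines "p \<equiv> op_apply (emb_adj H N)"
  shows "(y, z) \<in> emb_adj H N \<longleftrightarrow> y \<in> carrier H \<and> z = p y"
    and "y \<in> carrier H \<Longrightarrow> p y \<in> N"
    and "y \<in> carrier H \<Longrightarrow> x \<in> N \<Longrightarrow> \<langle>p y, x\<rangle> = \<langle>y, x\<rangle>"
    and "y \<in> carrier H \<Longrightarrow> z \<in> N \<Longrightarrow> (\<And>x. x \<in> N \<Longrightarrow> \<langle>z, x\<rangle> = \<langle>y, x\<rangle>) \<Longrightarrow> p y = z"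
proof -
  note ND = closed_subspaceD[OF N]
  have mem: "(y, z) \<in> emb_adj H N \<longleftrightarrow> y \<in> carrier H \<and> z \<in> N \<and> (\<forall>x\<in>N. \<langle>z, x\<rangle> = \<langle>y, x\<rangle>)" for y z
  proof -
    have "\<langle>x, y\<rangle> = \<langle>x, z\<rangle> \<longleftrightarrow> \<langle>z, x\<rangle> = \<langle>y, x\<rangle>" if "y \<in> carrier H" "z \<in> carrier H" "x \<in> carrier H" for x
      using cinner_commute[OF that(3,1)] cinner_commute[OF that(3,2)] by auto
    then show ?thesis
      using ND(1) by (fastforce simp: emb_adj_def adjoint_op_def emb_def)
  qed
  have uniq: "z = z'" if "(y, z) \<in> emb_adj H N" "(y, z') \<in> emb_adj H N" for y z z'
  proof -
    have z: "z \<in> N" "z' \<in> N" and eq: "\<forall>x\<in>N. \<langle>z, x\<rangle> = \<langle>z', x\<rangle>" using that by (auto simp: mem)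
    have zH: "z \<in> carrier H" "z' \<in> carrier H" using z ND(1) by auto
    have "\<langle>z \<ominus> z', z \<ominus> z'\<rangle> = 0"
      using eq ND(5)[OF z] zH by (simp only: cinner_minus_left[OF zH] minus_closed) simp
    then have "z \<ominus> z' = \<zero>" using zH by (intro cinner_eq_zero) simp_all
    then show ?thesis using zH by (simp add: minus_eq_zero_iff)
  qed
  have val: "p y = z" if "(y, z) \<in> emb_adj H N" for y z
    unfolding p_def op_apply_def using that uniq by blast
  have total: "(y, p y) \<in> emb_adj H N" if y: "y \<in> carrier H" for y
  proof -
    obtain z where z: "z \<in> N" "\<forall>x\<in>N. \<langle>y \<ominus> z, x\<rangle> = 0"
      using orthogonal_projection_exists[OF N y] by (rule bexE)
    have "\<langle>z, x\<rangle> = \<langle>y, x\<rangle>" if "x \<in> N" for x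
    proof -
      have "z \<in> carrier H" "x \<in> carrier H" using z(1) that ND(1) by auto
      moreover have "\<langle>y \<ominus> z, x\<rangle> = 0" using z(2) that by blast
      ultimately show ?thesis using y by (simp add: cinner_minus_left)
    qed
    then have "(y, z) \<in> emb_adj H N" using y z(1) by (simp add: mem)
    then show ?thesis using val by simp
  qed
  show "(y, z) \<in> emb_adj H N \<longleftrightarrow> y \<in> carrier H \<and> z = p y"
    using val[of y z] total[of y] by (auto simp: mem)
  show "p y \<in> N" if "y \<in> carrier H" using total[OF that] by (simp add: mem)
  show "\<langle>p y, x\<rangle> = \<langle>y, x\<rangle>" if "y \<in> carrier H" "x \<in> N" using total[OF that(1)] that by (simp add: mem)
  show "p y = z" if "y \<in> carrier H" "z \<in> N" "\<And>x. x \<in> N \<Longrightarrow> \<langle>z, x\<rangle> = \<langle>y, x\<rangle>"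
    by (rule val) (use that in \<open>simp add: mem\<close>)
qed

lemma proj_linear:
  assumes N: "closed_subspace H N"
  defines "p \<equiv> op_apply (emb_adj H N)"
  shows "x \<in> carrier H \<Longrightarrow> p x \<in> carrier H"
    and "x \<in> N \<Longrightarrow> p x = x"
    and "x \<in> carrier H \<Longrightarrow> y \<in> carrier H \<Longrightarrow> p (x \<oplus> y) = p x \<oplus> p y"
    and "x \<in> carrier H \<Longrightarrow> p (a \<odot> x) = a \<odot> p x"
    and "x \<in> carrier H \<Longrightarrow> y \<in> carrier H \<Longrightarrow> p (x \<ominus> y) = p x \<ominus> p y"
    and "x \<in> carrier H \<Longrightarrow> hnorm H (p x) \<le> hnorm H x"
proof -
  note ND = closed_subspaceD[OF N] and P = emb_adj_apply[OF N, folded p_def]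
  have NH [simp]: "z \<in> N \<Longrightarrow> z \<in> carrier H" for z using ND(1) by auto
  show pH: "p x \<in> carrier H" if "x \<in> carrier H" for x using P(2)[OF that] by simp
  show "p x = x" if "x \<in> N" by (rule P(4)) (use that in simp_all)
  show "p (x \<oplus> y) = p x \<oplus> p y" if "x \<in> carrier H" "y \<in> carrier H" for x y
    by (rule P(4)) (use that in \<open>simp_all add: ND(3) P(2,3) pH cinner_linear\<close>)
  show "p (a \<odot> x) = a \<odot> p x" if "x \<in> carrier H" for a x
    by (rule P(4)) (use that in \<open>simp_all add: ND(4) P(2,3) pH cinner_linear\<close>)
  show "p (x \<ominus> y) = p x \<ominus> p y" if "x \<in> carrier H" "y \<in> carrier H" for x y
    by (rule P(4)) (use that in \<open>simp_all add: ND(5) P(2,3) pH cinner_linear\<close>)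
  show "hnorm H (p x) \<le> hnorm H x" if x: "x \<in> carrier H"
  proof -
    have "hnorm H (p x) * hnorm H (p x) = Re \<langle>x, p x\<rangle>"
      using hnorm_sq[OF pH[OF x]] P(3)[OF x P(2)[OF x]] by (simp add: power2_eq_square)
    also have "\<dots> \<le> hnorm H x * hnorm H (p x)" by (rule Re_cinner_le[OF x pH[OF x]])
    finally have le: "hnorm H (p x) * hnorm H (p x) \<le> hnorm H x * hnorm H (p x)" .
    have "hnorm H (p x) > 0 \<or> hnorm H (p x) = 0" using hnorm_nonneg[OF pH[OF x]] by linarith
    then show ?thesis using le x by auto
  qed
qed

lemma mem_orth_proj:
  assumes N: "closed_subspace H N"
  shows "(y, z) \<in> orth_proj H N \<longleftrightarrow> y \<in> carrier H \<and> z = op_apply (emb_adj H N) y"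
  using emb_adj_apply(1,2)[OF N] by (auto simp: orth_proj_def op_comp_def emb_def)

lemma mem_compression:
  assumes N: "closed_subspace H N" and T: "T \<subseteq> carrier H \<times> carrier H"
  shows "(x, z) \<in> compression H N T \<longleftrightarrow> x \<in> N \<and> (\<exists>y. (x, y) \<in> T \<and> z = op_apply (emb_adj H N) y)"
  using emb_adj_apply(1)[OF N] T by (auto simp: compression_def op_comp_def emb_def)

lemma proj_orth_complement:
  assumes N: "closed_subspace H N" and x: "x \<in> carrier H"
  shows "op_apply (emb_adj H (orth_complement H N)) x = x \<ominus> op_apply (emb_adj H N) x"
proof -
  define p where "p = op_apply (emb_adj H N)"
  note P = emb_adj_apply[OF N, folded p_def]
  have NH: "N \<subseteq> carrier H" by (rule closed_subspaceD(1)[OF N])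
  have px: "p x \<in> N" "p x \<in> carrier H" using P(2)[OF x] NH by auto
  have "op_apply (emb_adj H (orth_complement H N)) x = x \<ominus> p x"
  proof (rule emb_adj_apply(4)[OF closed_subspace_orth_complement[OF NH] x])
    have "\<langle>x \<ominus> p x, y\<rangle> = 0" if "y \<in> N" for y
    proof -
      have "y \<in> carrier H" using that NH by auto
      then show ?thesis using x px P(3)[OF x that] by (simp add: cinner_minus_left)
    qed
    then show "x \<ominus> p x \<in> orth_complement H N" using x px by (simp add: orth_complement_def)
    fix r assume "r \<in> orth_complement H N"
    then have r: "r \<in> carrier H" "\<langle>r, p x\<rangle> = 0" using px by (auto simp: orth_complement_def)
    then have "\<langle>p x, r\<rangle> = 0" using cinner_commute[OF r(1) px(2)] by simp
    then show "\<langle>x \<ominus> p x, r\<rangle> = \<langle>x, r\<rangle>" using x px r by (simp add: cinner_minus_left)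
  qed
  then show ?thesis by (simp add: p_def)
qed

lemma compression_bounded:
  assumes N: "closed_subspace H N" and M: "M \<in> bounded_ops H H"
  shows "compression H N M \<in> bounded_ops (subsp H N) (subsp H N)"
proof -
  interpret S: complex_hilbert_space "subsp H N" by (rule complex_hilbert_space_subsp[OF N])
  define p m where "p = op_apply (emb_adj H N)" and "m = op_apply M"
  note P = emb_adj_apply[OF N, folded p_def] and L = proj_linear[OF N, folded p_def]
    and m = bounded_ops_apply[OF M, folded m_def]
  have NH: "x \<in> N \<Longrightarrow> x \<in> carrier H" for x using closed_subspaceD(1)[OF N] by auto
  have "M \<subseteq> carrier H \<times> carrier H" using M linear_operatorD(1) by (simp add: bounded_ops_def)
  note mc = mem_compression[OF N this, folded p_def]
  show ?thesis
  proof (rule S.bounded_opsI)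
    show "(x, y) \<in> compression H N M \<longleftrightarrow> x \<in> carrier (subsp H N) \<and> y = p (m x)" for x y
      using NH by (auto simp: mc m(1))
    show "hnorm (subsp H N) (p (m x)) \<le> enn2real (opnorm H H M) * hnorm (subsp H N) x"
      if "x \<in> carrier (subsp H N)" for x
    proof -
      have x: "x \<in> carrier H" using that NH by simp
      show ?thesis using L(6)[OF m(2)[OF x]] m(5)[OF x] by simp
    qed
  qed (simp_all add: NH m(2-4) P(2) L(3,4))
qed

lemma compression_accretive:
  assumes N: "closed_subspace H N" and M: "M \<subseteq> carrier H \<times> carrier H"
    and accretive: "\<And>x y. (x, y) \<in> M \<Longrightarrow> c * (hnorm H x)\<^sup>2 \<le> Re \<langle>y, x\<rangle>"
    and xz: "(x, z) \<in> compression H N M"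
  shows "c * (hnorm H x)\<^sup>2 \<le> Re \<langle>z, x\<rangle>"
proof -
  obtain y where y: "x \<in> N" "(x, y) \<in> M" "z = op_apply (emb_adj H N) y"
    using xz unfolding mem_compression[OF N M] by blast
  then have "\<langle>z, x\<rangle> = \<langle>y, x\<rangle>" using M emb_adj_apply(3)[OF N] by auto
  then show ?thesis using accretive[OF y(2)] by simp
qed

end

section \<open>Reducing subspaces\<close>

locale reduced_skew_selfadjoint = complex_hilbert_space H for H (structure) +
  fixes A :: "'a op_graph" and N :: "'a set"
  assumes skew: "skew_selfadjoint H A"
    and N: "closed_subspace H N"
    and reducing: "orth_proj H (orth_complement H N) \<cdot>\<^sub>o A \<subseteq> A \<cdot>\<^sub>o orth_proj H (orth_complement H N)"
begin

definition proj (\<open>\<pi>\<close>) where "\<pi> = op_apply (emb_adj H N)"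

lemmas proj_props = emb_adj_apply[OF N, folded proj_def]
lemmas proj_lin = proj_linear[OF N, folded proj_def]
lemmas A_props = skew_selfadjointD[OF skew]

lemma N_carrier: "x \<in> N \<Longrightarrow> x \<in> carrier H"
  using closed_subspaceD(1)[OF N] by auto

lemma closed_subspace_R: "closed_subspace H (orth_complement H N)"
  by (rule closed_subspace_orth_complement[OF closed_subspaceD(1)[OF N]])

lemma proj_R: "x \<in> carrier H \<Longrightarrow> op_apply (emb_adj H (orth_complement H N)) x = x \<ominus> \<pi> x"
  unfolding proj_def by (rule proj_orth_complement[OF N])

lemma A_minus: "(x, y) \<in> A \<Longrightarrow> (x', y') \<in> A \<Longrightarrow> (x \<ominus> x', y \<ominus> y') \<in> A"
  using A_props(5)[OF _ A_props(6)[of x' y' "-1"], of x y] A_props(1,2)[of x' y']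
  by (simp add: minus_eq uminus_eq_smult)

text \<open>The inclusion \<open>\<pi>\<^sub>R A \<subseteq> A \<pi>\<^sub>R\<close> is the statement for the block on \<open>R\<close>; subtracting it from \<open>A\<close> gives
  the block on \<open>N\<close>.\<close>

lemma A_blocks:
  assumes xy: "(x, y) \<in> A"
  shows "(x \<ominus> \<pi> x, y \<ominus> \<pi> y) \<in> A" and "(\<pi> x, \<pi> y) \<in> A"
proof -
  have x: "x \<in> carrier H" and y: "y \<in> carrier H" using A_props(1,2)[OF xy] by auto
  have "(x, y \<ominus> \<pi> y) \<in> orth_proj H (orth_complement H N) \<cdot>\<^sub>o A"
    unfolding op_comp_def
    by (rule relcompI[OF xy]) (use y in \<open>simp add: mem_orth_proj[OF closed_subspace_R] proj_R\<close>)
  then have "(x, y \<ominus> \<pi> y) \<in> A \<cdot>\<^sub>o orth_proj H (orth_complement H N)" using reducing by blast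
  then obtain v where "(x, v) \<in> orth_proj H (orth_complement H N)" "(v, y \<ominus> \<pi> y) \<in> A"
    unfolding op_comp_def by (rule relcompE) blast
  then show R: "(x \<ominus> \<pi> x, y \<ominus> \<pi> y) \<in> A"
    using x by (simp add: mem_orth_proj[OF closed_subspace_R] proj_R)
  have "z \<ominus> (z \<ominus> \<pi> z) = \<pi> z" if "z \<in> carrier H" for z
    by (rule eq_if_cinner_eq) (use that in \<open>simp_all add: proj_lin(1) cinner_linear\<close>)
  then show "(\<pi> x, \<pi> y) \<in> A" using A_minus[OF xy R] x y by simp
qed

lemma A_sub: "A \<subseteq> carrier H \<times> carrier H"
  using A_props(1,2) by auto

text \<open>That \<open>A\<close> is block diagonal is what makes the block on \<open>N\<close> skew-selfadjoint and not merely
  skew-symmetric: a condition tested only against \<open>N \<inter> dom A\<close> extends to all of \<open>dom A\<close>, because the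
  component in \<open>R\<close> and its image under \<open>A\<close> are orthogonal to \<open>N\<close>.\<close>

lemma skew_selfadjoint_compression: "skew_selfadjoint (subsp H N) (compression H N A)"
proof -
  note mc = mem_compression[OF N A_sub, folded proj_def]
  have "(z, w) \<in> compression H N A \<longleftrightarrow> (\<forall>(x, y)\<in>compression H N A. \<langle>y, z\<rangle> = - \<langle>x, w\<rangle>)"
    if z: "z \<in> N" and w: "w \<in> N" for z w
  proof
    assume "(z, w) \<in> compression H N A"
    then obtain v where v: "(z, v) \<in> A" "w = \<pi> v" using mc by blast
    then have zw: "(z, w) \<in> A" using A_blocks(2)[OF v(1)] proj_lin(2)[OF z] by simp
    show "\<forall>(x, y)\<in>compression H N A. \<langle>y, z\<rangle> = - \<langle>x, w\<rangle>"
    proof clarify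
      fix x y assume "(x, y) \<in> compression H N A"
      then obtain y' where y': "x \<in> N" "(x, y') \<in> A" "y = \<pi> y'" using mc by blast
      then show "\<langle>y, z\<rangle> = - \<langle>x, w\<rangle>"
        using A_props(3)[OF y'(2) zw] proj_props(3)[OF A_props(2)[OF y'(2)] z] by simp
    qed
  next
    assume R: "\<forall>(x, y)\<in>compression H N A. \<langle>y, z\<rangle> = - \<langle>x, w\<rangle>"
    have "(z, w) \<in> A"
    proof (rule skew_selfadjointI[OF skew])
      fix x y assume xy: "(x, y) \<in> A"
      have x: "x \<in> carrier H" and y: "y \<in> carrier H" using A_props(1,2)[OF xy] by auto
      have "(\<pi> x, \<pi> y) \<in> compression H N A"
        using A_blocks(2)[OF xy] proj_props(2)[OF x] proj_lin(2)[OF proj_props(2)[OF y]]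
        unfolding mc by metis
      then have "\<langle>\<pi> y, z\<rangle> = - \<langle>\<pi> x, w\<rangle>" using R by blast
      then show "\<langle>y, z\<rangle> = - \<langle>x, w\<rangle>" using proj_props(3)[OF x w] proj_props(3)[OF y z] by simp
    qed (use z w N_carrier in auto)
    then show "(z, w) \<in> compression H N A" using z proj_lin(2)[OF w] unfolding mc by metis
  qed
  moreover have "compression H N A \<subseteq> N \<times> N"
    using proj_props(2) A_props(2) mc by auto
  ultimately show ?thesis by (simp add: skew_selfadjoint_def)
qed

text \<open>If \<open>A \<pi>\<^sub>N\<close> is bounded on its domain then, \<open>A\<close> being closed and densely defined, \<open>N\<close> lies in the
  domain of \<open>A\<close>: approximate a point of \<open>N\<close> from the domain and project the
  approximations back to \<open>N\<close>.\<close>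

lemma N_subset_Domain:
  assumes dense: "densely_defined H A" and fin: "opnorm H H (A \<cdot>\<^sub>o orth_proj H N) < \<infinity>"
  shows "\<exists>k\<ge>0. \<forall>x\<in>N. \<exists>y\<in>N. (x, y) \<in> A \<and> hnorm H y \<le> k * hnorm H x"
proof -
  define T where "T = A \<cdot>\<^sub>o orth_proj H N"
  define k where "k = enn2real (opnorm H H T)"
  have mem: "(x, y) \<in> T \<longleftrightarrow> x \<in> carrier H \<and> (\<pi> x, y) \<in> A" for x y
    unfolding T_def op_comp_def by (auto simp: mem_orth_proj[OF N] proj_def)
  have "k \<ge> 0" by (simp add: k_def)
  have "\<forall>(x, y)\<in>T. hnorm H y \<le> k * hnorm H x"
  proof (rule iffD1[OF opnorm_le_iff[OF _ _ \<open>k \<ge> 0\<close>]])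
    show "T \<subseteq> carrier H \<times> carrier H" using A_props(2) by (auto simp: mem)
    show "(a \<odot> x, a \<odot> y) \<in> T" if "(x, y) \<in> T" for a x y
      using that A_props(6) by (simp add: mem proj_lin(4))
    show "opnorm H H T \<le> ennreal k" using fin by (simp add: k_def T_def)
  qed
  then have bound: "hnorm H y \<le> k * hnorm H x" if "x \<in> N" "(x, y) \<in> A" for x y
    using that N_carrier[OF that(1)] proj_lin(2)[OF that(1)] by (auto simp: mem)
  have "\<exists>y\<in>N. (x, y) \<in> A" if xN: "x \<in> N" for x
  proof -
    have x [simp]: "x \<in> carrier H" by (rule N_carrier[OF xN])
    have "\<exists>z t. (z, t) \<in> A \<and> hnorm H (z \<ominus> x) < 1 / real (Suc n)" for n
    proof -
      have "x \<in> Metric_space.mtopology (carrier H) (hdist H) closure_of Domain A"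
        using dense by (simp add: densely_defined_def htopology_def)
      then have near: "\<forall>r>0. \<exists>z\<in>Domain A. z \<in> Metric_space.mball (carrier H) (hdist H) x r"
        unfolding Metric_space.metric_closure_of[OF Metric_space_hdist]
        by simp
      have "1 / real (Suc n) > 0" by simp
      from near[rule_format, OF this] obtain z where z: "z \<in> Domain A"
        "z \<in> Metric_space.mball (carrier H) (hdist H) x (1 / real (Suc n))" by (rule bexE)
      then have "z \<in> carrier H" "hdist H x z < 1 / real (Suc n)"
        by (simp_all add: Metric_space.in_mball[OF Metric_space_hdist])
      then have "hnorm H (z \<ominus> x) < 1 / real (Suc n)"
        using hnorm_minus_commute[of z x] by (simp add: hdist_def)
      then show ?thesis using z(1) by blast
    qed
    then obtain s t where st: "\<And>n. (s n, t n) \<in> A"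
      and s_lt: "\<And>n. hnorm H (s n \<ominus> x) < 1 / real (Suc n)" by metis
    have H [simp]: "s n \<in> carrier H" "t n \<in> carrier H" for n using A_props(1,2)[OF st] by auto
    define s' t' where "s' n = \<pi> (s n)" and "t' n = \<pi> (t n)" for n
    have H' [simp]: "s' n \<in> N" "t' n \<in> N" "s' n \<in> carrier H" "t' n \<in> carrier H" for n
      by (simp_all add: s'_def t'_def proj_props(2) proj_lin(1))
    have A': "(s' n, t' n) \<in> A" for n unfolding s'_def t'_def by (rule A_blocks(2)[OF st])
    have s': "hconverges H s' x"
    proof (rule hconverges_dominated)
      show "(\<lambda>n. 1 / real (Suc n)) \<longlonglongrightarrow> 0" by (rule LIMSEQ_Suc[OF lim_1_over_n])
      fix n
      have "s' n \<ominus> x = \<pi> (s n \<ominus> x)" by (simp add: s'_def proj_lin(5) proj_lin(2)[OF xN])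
      then show "hnorm H (s' n \<ominus> x) \<le> 1 / real (Suc n)"
        using proj_lin(6)[of "s n \<ominus> x"] s_lt[of n] by simp
    qed auto
    have "hCauchy H t'"
    proof (rule hCauchy_dominated[OF hconverges_imp_hCauchy[OF s'] _ \<open>k \<ge> 0\<close>])
      show "hnorm H (t' i \<ominus> t' j) \<le> k * hnorm H (s' i \<ominus> s' j)" for i j
        by (rule bound[OF closed_subspaceD(5)[OF N] A_minus[OF A' A']]) simp_all
    qed auto
    then obtain y where y: "hconverges H t' y" using hCauchy_converges by blast
    have yN: "y \<in> N" by (rule closed_subspaceD(6)[OF N _ y]) auto
    then have yH [simp]: "y \<in> carrier H" by (rule N_carrier)
    have "(x, y) \<in> A"
    proof (rule skew_selfadjointI[OF skew])
      fix u v assume uv: "(u, v) \<in> A"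
      then have [simp]: "u \<in> carrier H" "v \<in> carrier H" using A_props(1,2) by auto
      have "\<langle>t' n, u\<rangle> = - \<langle>s' n, v\<rangle>" for n by (rule A_props(3)[OF A' uv])
      moreover have "(\<lambda>n. - \<langle>s' n, v\<rangle>) \<longlonglongrightarrow> - \<langle>x, v\<rangle>"
        by (intro tendsto_minus hconverges_cinner[OF s']) simp
      ultimately have "\<langle>y, u\<rangle> = - \<langle>x, v\<rangle>"
        using LIMSEQ_unique[OF hconverges_cinner[OF y, of u]] by simp
      then show "\<langle>v, x\<rangle> = - \<langle>u, y\<rangle>" using cinner_commute[of y u] cinner_commute[of x v] by simp
    qed simp_all
    then show ?thesis using yN by blast
  qed
  then have "\<exists>y\<in>N. (x, y) \<in> A \<and> hnorm H y \<le> k * hnorm H x" if "x \<in> N" for x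
    using bound that by metis
  then show ?thesis using \<open>k \<ge> 0\<close> by (intro exI[of _ k] conjI ballI)
qed

lemma compression_A_bounded:
  assumes dense: "densely_defined H A" and fin: "opnorm H H (A \<cdot>\<^sub>o orth_proj H N) < \<infinity>"
    and sv: "single_valued A"
  shows "compression H N A \<in> bounded_ops (subsp H N) (subsp H N)"
proof -
  interpret S: complex_hilbert_space "subsp H N" by (rule complex_hilbert_space_subsp[OF N])
  obtain k where "k \<ge> 0" and ex: "\<forall>x\<in>N. \<exists>y\<in>N. (x, y) \<in> A \<and> hnorm H y \<le> k * hnorm H x"
    using N_subset_Domain[OF dense fin] by blast
  define a where "a = op_apply A"
  have val: "a x = y" if "(x, y) \<in> A" for x y
    unfolding a_def op_apply_def using that sv by (auto dest: single_valuedD)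
  have a: "a x \<in> N" "(x, a x) \<in> A" "hnorm H (a x) \<le> k * hnorm H x" if x: "x \<in> N" for x
  proof -
    obtain y where y: "y \<in> N" "(x, y) \<in> A" "hnorm H y \<le> k * hnorm H x"
      using bspec[OF ex x] by blast
    then show "a x \<in> N" "(x, a x) \<in> A" "hnorm H (a x) \<le> k * hnorm H x"
      by (simp_all only: val[OF y(2)])
  qed
  note mc = mem_compression[OF N A_sub, folded proj_def]
  show ?thesis
  proof (rule S.bounded_opsI[OF _ _ _ _ _ \<open>k \<ge> 0\<close>])
    show "(x, y) \<in> compression H N A \<longleftrightarrow> x \<in> carrier (subsp H N) \<and> y = a x" for x y
    proof
      assume "(x, y) \<in> compression H N A"
      then obtain y' where y': "x \<in> N" "(x, y') \<in> A" "y = \<pi> y'" unfolding mc by blast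
      then show "x \<in> carrier (subsp H N) \<and> y = a x"
        using proj_lin(2)[OF a(1)[OF y'(1)]] val[OF y'(2)] by simp
    next
      assume "x \<in> carrier (subsp H N) \<and> y = a x"
      then have "x \<in> N" "y = \<pi> (a x)" using proj_lin(2)[OF a(1)] by simp_all
      then show "(x, y) \<in> compression H N A" unfolding mc using a(2) by blast
    qed
    show "a (x \<oplus>\<^bsub>subsp H N\<^esub> y) = a x \<oplus>\<^bsub>subsp H N\<^esub> a y"
      if "x \<in> carrier (subsp H N)" "y \<in> carrier (subsp H N)" for x y
      unfolding subsp_simps by (rule val, rule A_props(5)) (use that a(2) in auto)
    show "a (b \<odot>\<^bsub>subsp H N\<^esub> x) = b \<odot>\<^bsub>subsp H N\<^esub> a x" if "x \<in> carrier (subsp H N)" for b x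
      unfolding subsp_simps by (rule val, rule A_props(6)) (use that a(2) in auto)
  qed (use a in auto)
qed

end

section \<open>The resolvent estimate\<close>

text \<open>The operator on \<open>N\<close> is of the same kind as the one on \<open>H\<close>, so the
  invertibility theorem applies to it in the Hilbert space \<open>N\<close>.\<close>

lemma BN_op_eq_B_op: "BN_op H N M A \<epsilon> = B_op (subsp H N) (compression H N M) (compression H N A) \<epsilon>"
  by (simp add: BN_op_def B_op_def)

context reduced_skew_selfadjoint
begin

text \<open>As \<open>N\<close> reduces \<open>A\<close>, the values of \<open>A\<close> on \<open>N\<close> stay in \<open>N\<close>: only \<open>M\<close> has to be projected.\<close>

lemma mem_BN_op:
  assumes M: "M \<in> bounded_ops H H" and "(u, g) \<in> BN_op H N M A \<epsilon>"
  shows "u \<in> N \<and> (\<exists>v\<in>N. (u, v) \<in> A \<and>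
           g = \<pi> (op_apply M u) \<oplus> complex_of_real (1 / \<epsilon>) \<odot> v)"
proof -
  interpret S: complex_hilbert_space "subsp H N" by (rule complex_hilbert_space_subsp[OF N])
  have M_sub: "M \<subseteq> carrier H \<times> carrier H" using M linear_operatorD(1) by (simp add: bounded_ops_def)
  obtain z v where z: "(u, z) \<in> compression H N M" and v: "(u, v) \<in> compression H N A"
    and g: "g = z \<oplus> complex_of_real (1 / \<epsilon>) \<odot> v"
    using assms(2) unfolding BN_op_eq_B_op S.mem_B_op_iff by auto
  have u: "u \<in> N" and zu: "z = \<pi> (op_apply M u)"
    using z bounded_ops_apply(1)[OF M] unfolding mem_compression[OF N M_sub] proj_def by auto
  obtain y where y: "(u, y) \<in> A" "v = \<pi> y"
    using v unfolding mem_compression[OF N A_sub] proj_def by blast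
  then have "(u, v) \<in> A" using A_blocks(2)[OF y(1)] proj_lin(2)[OF u] by simp
  moreover have "v \<in> N" using y A_props(2)[OF y(1)] proj_props(2) by simp
  ultimately show ?thesis using u g zu by blast
qed

text \<open>For vectors of \<open>R\<close> the block \<open>A\<^sub>R\<close> has the same values as \<open>A\<close>, so the bound on its inverse
  bounds \<open>A\<close> below there.\<close>

lemma A_R_lower_bound:
  assumes inv: "(compression H (orth_complement H N) A)\<inverse>
      \<in> bounded_ops (subsp H (orth_complement H N)) (subsp H (orth_complement H N))"
    and C: "opnorm H H ((compression H (orth_complement H N) A)\<inverse>) \<le> ennreal C" "C \<ge> 0"
    and xy: "(x, y) \<in> A" and x: "x \<in> orth_complement H N" and y: "y \<in> orth_complement H N"
  shows "hnorm H x \<le> C * hnorm H y"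
proof -
  let ?R = "orth_complement H N"
  interpret S: complex_hilbert_space "subsp H ?R"
    by (rule complex_hilbert_space_subsp[OF closed_subspace_R])
  have lin: "linear_operator (subsp H ?R) (subsp H ?R) ((compression H ?R A)\<inverse>)"
    using inv by (simp add: bounded_ops_def)
  have "op_apply (emb_adj H ?R) y = y" by (rule proj_linear(2)[OF closed_subspace_R y])
  then have "(x, y) \<in> compression H ?R A"
    using xy x unfolding mem_compression[OF closed_subspace_R A_sub] by metis
  then have "(y, x) \<in> (compression H ?R A)\<inverse>" by simp
  moreover have "\<forall>(y, x)\<in>(compression H ?R A)\<inverse>. hnorm (subsp H ?R) x \<le> C * hnorm (subsp H ?R) y"
    using S.opnorm_le_iff[OF S.linear_operatorD(1,5)[OF lin] C(2)] C(1) by simp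
  ultimately have "hnorm (subsp H ?R) x \<le> C * hnorm (subsp H ?R) y" by blast
  then show ?thesis by simp
qed

text \<open>Let \<open>M x + A x / \<epsilon> = f\<close>, and split \<open>x = \<pi> x + r\<close>. Projecting the equation to \<open>R\<close> gives
  \<open>A r = \<epsilon> (1 - \<pi>) (f - M x)\<close>, and \<open>\<parallel>x\<parallel> \<le> \<parallel>f\<parallel> / c\<close>; hence \<open>\<parallel>r\<parallel> \<le> C \<epsilon> (1 + m / c) \<parallel>f\<parallel>\<close>. Projecting it
  to \<open>N\<close> and subtracting the equation of \<open>u\<close> shows that \<open>w = \<pi> x - u\<close> satisfies
  \<open>\<pi> M w + A w / \<epsilon> = - \<pi> M r\<close>, so that \<open>\<parallel>w\<parallel> \<le> (m / c) \<parallel>r\<parallel>\<close> by coercivity. The first factor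
  \<open>1 + m / c\<close> of the bound comes from \<open>f - M x\<close>, the second from \<open>x - u = w + r\<close>.\<close>

lemma resolvent_difference_bound:
  fixes \<epsilon> :: real
  assumes M: "M \<in> bounded_ops H H" and Mm: "opnorm H H M \<le> ennreal m" "m \<ge> 0"
    and accretive: "\<And>x y. (x, y) \<in> M \<Longrightarrow> c * (hnorm H x)\<^sup>2 \<le> Re \<langle>y, x\<rangle>" and c: "c > 0"
    and inv: "(compression H (orth_complement H N) A)\<inverse>
      \<in> bounded_ops (subsp H (orth_complement H N)) (subsp H (orth_complement H N))"
    and C: "opnorm H H ((compression H (orth_complement H N) A)\<inverse>) \<le> ennreal C" "C \<ge> 0"
    and \<epsilon>: "\<epsilon> > 0"
    and xf: "(x, f) \<in> B_op H M A \<epsilon>" and u: "(u, \<pi> f) \<in> BN_op H N M A \<epsilon>"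
  shows "hnorm H (x \<oplus> \<ominus> u) \<le> C * (1 + m / c)\<^sup>2 * \<epsilon> * hnorm H f"
proof -
  define e where "e = complex_of_real (1 / \<epsilon>)"
  define T where "T = op_apply M"
  note T = bounded_ops_apply(1-4)[OF M, folded T_def]
  have M_sub: "M \<subseteq> carrier H \<times> carrier H" using M linear_operatorD(1) by (simp add: bounded_ops_def)
  have T_bound: "hnorm H (T z) \<le> m * hnorm H z" if "z \<in> carrier H" for z
  proof -
    have "enn2real (opnorm H H M) \<le> m" using enn2real_leI[OF Mm(2,1)] .
    then have "enn2real (opnorm H H M) * hnorm H z \<le> m * hnorm H z"
      using that by (intro mult_right_mono) simp_all
    then show ?thesis using bounded_ops_apply(5)[OF M that] by (simp add: T_def)
  qed
  obtain y where xy: "(x, y) \<in> A" and f: "f = T x \<oplus> e \<odot> y"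
    using xf unfolding mem_B_op_iff T(1) e_def by blast
  obtain v where uN: "u \<in> N" and vN: "v \<in> N" and uv: "(u, v) \<in> A"
    and pf: "\<pi> f = \<pi> (T u) \<oplus> e \<odot> v"
    using mem_BN_op[OF M u] unfolding T_def e_def by blast
  have H [simp]: "x \<in> carrier H" "y \<in> carrier H" "u \<in> carrier H" "v \<in> carrier H"
    using A_props(1,2)[OF xy] A_props(1,2)[OF uv] by auto
  have fH [simp]: "f \<in> carrier H" by (simp add: f T(2))
  have "c * hnorm H x \<le> hnorm H f" by (rule B_op_coercive[OF M_sub skew accretive xf])
  then have x_bound: "hnorm H x \<le> hnorm H f / c" using c by (simp add: field_simps)
  \<comment> \<open>The component in \<open>R\<close> is small, because \<open>A\<close> is large there.\<close>
  define r where "r = x \<ominus> \<pi> x"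
  have R: "z \<ominus> \<pi> z \<in> orth_complement H N" "hnorm H (z \<ominus> \<pi> z) \<le> hnorm H z"
    if "z \<in> carrier H" for z
    using emb_adj_apply(2)[OF closed_subspace_R that] proj_linear(6)[OF closed_subspace_R that]
    by (simp_all add: proj_R that)
  have rH [simp]: "r \<in> carrier H" by (simp add: r_def proj_lin(1))
  have "hnorm H r \<le> C * hnorm H (y \<ominus> \<pi> y)"
    unfolding r_def by (rule A_R_lower_bound[OF inv C A_blocks(1)[OF xy] R(1) R(1)]) simp_all
  also have "hnorm H (y \<ominus> \<pi> y) \<le> hnorm H y" by (rule R(2)) simp
  also have "y = complex_of_real \<epsilon> \<odot> (f \<ominus> T x)"
    by (rule eq_if_cinner_eq) (use \<epsilon> in \<open>simp_all add: f T(2) e_def cinner_linear\<close>)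
  also have "hnorm H \<dots> \<le> \<epsilon> * (hnorm H f + m * (hnorm H f / c))"
  proof -
    have "m * hnorm H x \<le> m * (hnorm H f / c)" by (intro mult_left_mono x_bound Mm(2))
    then have "hnorm H (f \<ominus> T x) \<le> hnorm H f + m * (hnorm H f / c)"
      using hnorm_triangle_minus[of f "T x"] T_bound[of x] by (simp add: T(2))
    then show ?thesis using \<epsilon> by (simp add: hnorm_smult T(2))
  qed
  finally have r_bound: "hnorm H r \<le> C * (\<epsilon> * (hnorm H f + m * (hnorm H f / c)))"
    using C(2) by (simp add: mult_left_mono)
  \<comment> \<open>The error in \<open>N\<close> solves the equation in \<open>N\<close> with right-hand side \<open>- \<pi> M r\<close>.\<close>
  define w where "w = \<pi> x \<ominus> u"
  have wN: "w \<in> N" unfolding w_def by (intro closed_subspaceD(5)[OF N] proj_props(2) uN) simp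
  have wH [simp]: "w \<in> carrier H" by (rule N_carrier[OF wN])
  have wA: "(w, \<pi> y \<ominus> v) \<in> A" unfolding w_def by (rule A_minus[OF A_blocks(2)[OF xy] uv])
  have py: "\<pi> y \<in> carrier H" by (simp add: proj_lin(1))
  have eq: "\<langle>T x, w\<rangle> + e * \<langle>y, w\<rangle> = \<langle>T u, w\<rangle> + e * \<langle>v, w\<rangle>"
  proof -
    have "\<langle>T x, w\<rangle> + e * \<langle>y, w\<rangle> = \<langle>f, w\<rangle>" by (simp add: f T(2) cinner_linear)
    also have "\<dots> = \<langle>\<pi> f, w\<rangle>" using proj_props(3)[OF fH wN] by simp
    also have "\<dots> = \<langle>\<pi> (T u), w\<rangle> + e * \<langle>v, w\<rangle>" unfolding pf by (simp add: T(2) proj_lin(1) cinner_linear)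
    also have "\<langle>\<pi> (T u), w\<rangle> = \<langle>T u, w\<rangle>" using wN by (simp add: T(2) proj_props(3))
    finally show ?thesis .
  qed
  have "\<langle>\<pi> y \<ominus> v, w\<rangle> = \<langle>y, w\<rangle> - \<langle>v, w\<rangle>"
    using py wN by (simp add: cinner_linear proj_props(3))
  moreover have "\<langle>T x, w\<rangle> = \<langle>T u, w\<rangle> + e * \<langle>v, w\<rangle> - e * \<langle>y, w\<rangle>"
    using eq by (simp only: eq_diff_eq)
  ultimately have "\<langle>T x, w\<rangle> - \<langle>T u, w\<rangle> = - (e * \<langle>\<pi> y \<ominus> v, w\<rangle>)"
    by (simp add: right_diff_distrib)
  moreover have "Re (e * \<langle>\<pi> y \<ominus> v, w\<rangle>) = 0" using A_props(7)[OF wA] by (simp add: e_def)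
  moreover have "T x = (T w \<oplus> T u) \<oplus> T r"
  proof -
    have "x = (w \<oplus> u) \<oplus> r"
      by (rule eq_if_cinner_eq) (simp_all add: w_def r_def proj_lin(1) cinner_linear)
    then have "T x = T ((w \<oplus> u) \<oplus> r)" by simp
    then show ?thesis by (simp add: T(3))
  qed
  then have "\<langle>T x, w\<rangle> = \<langle>T w, w\<rangle> + \<langle>T u, w\<rangle> + \<langle>T r, w\<rangle>" by (simp add: T(2) cinner_linear)
  ultimately have "Re \<langle>T w, w\<rangle> = - Re \<langle>T r, w\<rangle>" by (simp add: complex_eq_iff)
  also have "\<dots> \<le> hnorm H (T r) * hnorm H w"
    using Cauchy_Schwarz[of "T r" w] abs_Re_le_cmod[of "\<langle>T r, w\<rangle>"] by (simp add: T(2))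
  also have "\<dots> \<le> (m * hnorm H r) * hnorm H w" by (intro mult_right_mono T_bound) simp_all
  finally have "c * hnorm H w * hnorm H w \<le> m * hnorm H r * hnorm H w"
    using accretive[of w "T w"] by (simp add: T(1) power2_eq_square mult.assoc)
  moreover have "hnorm H w > 0 \<or> hnorm H w = 0" using hnorm_nonneg[OF wH] by linarith
  moreover have "m * hnorm H r \<ge> 0" using Mm(2) by simp
  ultimately have "c * hnorm H w \<le> m * hnorm H r" by auto
  then have w_bound: "hnorm H w \<le> (m / c) * hnorm H r" using c by (simp add: field_simps)
  have "x \<oplus> \<ominus> u = w \<oplus> r"
    by (rule eq_if_cinner_eq) (simp_all add: w_def r_def proj_lin(1) cinner_linear)
  then have "hnorm H (x \<oplus> \<ominus> u) \<le> hnorm H w + hnorm H r" by (simp add: hnorm_triangle)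
  also have "\<dots> \<le> (1 + m / c) * hnorm H r" using w_bound by (simp add: algebra_simps)
  also have "\<dots> \<le> (1 + m / c) * (C * (\<epsilon> * (hnorm H f + m * (hnorm H f / c))))"
    using Mm(2) c by (intro mult_left_mono r_bound) simp
  also have "hnorm H f + m * (hnorm H f / c) = (1 + m / c) * hnorm H f" by (simp add: algebra_simps)
  also have "(1 + m / c) * (C * (\<epsilon> * ((1 + m / c) * hnorm H f)))
      = C * (1 + m / c)\<^sup>2 * \<epsilon> * hnorm H f" by (simp only: power2_eq_square mult_ac)
  finally show ?thesis .
qed

theorem resolvent_estimate:
  fixes \<epsilon> :: real
  assumes M: "M \<in> bounded_ops H H" and Mm: "opnorm H H M \<le> ennreal m" "m \<ge> 0"
    and accretive: "\<And>x y. (x, y) \<in> M \<Longrightarrow> c * (hnorm H x)\<^sup>2 \<le> Re \<langle>y, x\<rangle>" and c: "c > 0"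
    and dense: "densely_defined H A" and sv: "single_valued A"
    and fin: "opnorm H H (A \<cdot>\<^sub>o orth_proj H N) < \<infinity>"
    and inv: "(compression H (orth_complement H N) A)\<inverse>
      \<in> bounded_ops (subsp H (orth_complement H N)) (subsp H (orth_complement H N))"
    and C: "opnorm H H ((compression H (orth_complement H N) A)\<inverse>) \<le> ennreal C" "C \<ge> 0"
    and \<epsilon>: "\<epsilon> > 0"
  shows "(B_op H M A \<epsilon>)\<inverse> \<in> bounded_ops H H"
    and "BN_op H N M A \<epsilon> \<in> bounded_ops (subsp H N) (subsp H N)"
    and "(BN_op H N M A \<epsilon>)\<inverse> \<in> bounded_ops (subsp H N) (subsp H N)"
    and "opnorm H H (op_diff H ((B_op H M A \<epsilon>)\<inverse>) (emb N \<cdot>\<^sub>o (BN_op H N M A \<epsilon>)\<inverse> \<cdot>\<^sub>o emb_adj H N))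
           \<le> ennreal (C * (1 + m / c)\<^sup>2 * \<epsilon>)"
proof -
  interpret S: complex_hilbert_space "subsp H N" by (rule complex_hilbert_space_subsp[OF N])
  have M_sub: "M \<subseteq> carrier H \<times> carrier H" using M linear_operatorD(1) by (simp add: bounded_ops_def)
  have \<epsilon>0: "\<epsilon> \<noteq> 0" using \<epsilon> by simp
  note MN = compression_bounded[OF N M]
  show "(B_op H M A \<epsilon>)\<inverse> \<in> bounded_ops H H"
    by (rule B_op_inverse_bounded[OF M skew c \<epsilon>0 accretive])
  show "BN_op H N M A \<epsilon> \<in> bounded_ops (subsp H N) (subsp H N)"
    unfolding BN_op_eq_B_op
    by (rule S.B_op_bounded[OF MN compression_A_bounded[OF dense fin sv]])
  show "(BN_op H N M A \<epsilon>)\<inverse> \<in> bounded_ops (subsp H N) (subsp H N)"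
    unfolding BN_op_eq_B_op
  proof (rule S.B_op_inverse_bounded[OF MN skew_selfadjoint_compression c \<epsilon>0])
    show "c * (hnorm (subsp H N) x)\<^sup>2 \<le> Re \<langle>y, x\<rangle>\<^bsub>subsp H N\<^esub>" if "(x, y) \<in> compression H N M" for x y
      using compression_accretive[OF N M_sub accretive that] by simp
  qed
  show "opnorm H H (op_diff H ((B_op H M A \<epsilon>)\<inverse>)
          (emb N \<cdot>\<^sub>o (BN_op H N M A \<epsilon>)\<inverse> \<cdot>\<^sub>o emb_adj H N)) \<le> ennreal (C * (1 + m / c)\<^sup>2 * \<epsilon>)"
  proof (rule opnorm_leI)
    show "0 \<le> C * (1 + m / c)\<^sup>2 * \<epsilon>" using C(2) \<epsilon> by simp
    fix f z assume "(f, z) \<in> op_diff H ((B_op H M A \<epsilon>)\<inverse>)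
      (emb N \<cdot>\<^sub>o (BN_op H N M A \<epsilon>)\<inverse> \<cdot>\<^sub>o emb_adj H N)"
    then obtain x u g where "(x, f) \<in> B_op H M A \<epsilon>" "(f, g) \<in> emb_adj H N"
      "(u, g) \<in> BN_op H N M A \<epsilon>" "z = x \<oplus> \<ominus> u"
      unfolding op_diff_def op_add_def op_uminus_def op_comp_def emb_def by blast
    then show "hnorm H z \<le> C * (1 + m / c)\<^sup>2 * \<epsilon> * hnorm H f"
      using resolvent_difference_bound[OF M Mm accretive c inv C \<epsilon>] by (simp add: proj_props(1))
  qed
qed

end

theorem proposition2p11:
  fixes \<Theta> :: "'t set"
    and H :: "'t \<Rightarrow> 'a inner_space"
    and M A :: "'t \<Rightarrow> 'a op_graph"
    and N R :: "'t \<Rightarrow> 'a set"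
    and c :: real
    and Msup C\<^sub>R \<epsilon>\<^sub>0 :: ennreal
  assumes "\<Theta> \<noteq> {}"
    and "\<And>\<theta>. \<theta> \<in> \<Theta> \<Longrightarrow> complex_hilbert_space (H \<theta>)"
    and "\<And>\<theta>. \<theta> \<in> \<Theta> \<Longrightarrow> M \<theta> \<in> bounded_ops (H \<theta>) (H \<theta>)"
    and "Msup = (SUP \<theta>\<in>\<Theta>. opnorm (H \<theta>) (H \<theta>) (M \<theta>))" and "Msup < \<infinity>"
    and "\<And>\<theta>. \<theta> \<in> \<Theta> \<Longrightarrow> linear_operator (H \<theta>) (H \<theta>) (A \<theta>)"
    and "\<And>\<theta>. \<theta> \<in> \<Theta> \<Longrightarrow> densely_defined (H \<theta>) (A \<theta>)"
    and "\<And>\<theta>. \<theta> \<in> \<Theta> \<Longrightarrow> closed_operator (H \<theta>) (H \<theta>) (A \<theta>)"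
    and "c > 0"
    and "\<And>\<theta>. \<theta> \<in> \<Theta> \<Longrightarrow> op_ge (H \<theta>) (re_op (H \<theta>) (M \<theta>)) c"
    and "\<And>\<theta>. \<theta> \<in> \<Theta> \<Longrightarrow> A \<theta> = op_uminus (H \<theta>) (adjoint_op (H \<theta>) (H \<theta>) (A \<theta>))"
    and "\<And>\<theta>. \<theta> \<in> \<Theta> \<Longrightarrow> closed_subspace (H \<theta>) (N \<theta>)"
    and "\<And>\<theta>. \<theta> \<in> \<Theta> \<Longrightarrow> R \<theta> = orth_complement (H \<theta>) (N \<theta>)"
    and "\<And>\<theta>. \<theta> \<in> \<Theta> \<Longrightarrow> opnorm (H \<theta>) (H \<theta>) (A \<theta> \<cdot>\<^sub>o orth_proj (H \<theta>) (N \<theta>)) < \<infinity>"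
    and "\<And>\<theta>. \<theta> \<in> \<Theta> \<Longrightarrow>
           orth_proj (H \<theta>) (R \<theta>) \<cdot>\<^sub>o A \<theta> \<subseteq> A \<theta> \<cdot>\<^sub>o orth_proj (H \<theta>) (R \<theta>)"
    and "\<And>\<theta>. \<theta> \<in> \<Theta> \<Longrightarrow>
           (compression (H \<theta>) (R \<theta>) (A \<theta>))\<inverse>
             \<in> bounded_ops (subsp (H \<theta>) (R \<theta>)) (subsp (H \<theta>) (R \<theta>))"
    and "C\<^sub>R = (SUP \<theta>\<in>\<Theta>. opnorm (subsp (H \<theta>) (R \<theta>)) (subsp (H \<theta>) (R \<theta>))
                          ((compression (H \<theta>) (R \<theta>) (A \<theta>))\<inverse>))"
    and "C\<^sub>R < \<infinity>"
    and "\<epsilon>\<^sub>0 = 1 / (2 * C\<^sub>R * Msup)"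
  shows "\<forall>\<epsilon>::real. \<forall>\<theta>\<in>\<Theta>. 0 < \<epsilon> \<and> ennreal \<epsilon> < \<epsilon>\<^sub>0 \<longrightarrow>
           (B_op (H \<theta>) (M \<theta>) (A \<theta>) \<epsilon>)\<inverse> \<in> bounded_ops (H \<theta>) (H \<theta>) \<and>
           BN_op (H \<theta>) (N \<theta>) (M \<theta>) (A \<theta>) \<epsilon>
             \<in> bounded_ops (subsp (H \<theta>) (N \<theta>)) (subsp (H \<theta>) (N \<theta>)) \<and>
           (BN_op (H \<theta>) (N \<theta>) (M \<theta>) (A \<theta>) \<epsilon>)\<inverse>
             \<in> bounded_ops (subsp (H \<theta>) (N \<theta>)) (subsp (H \<theta>) (N \<theta>)) \<and>
           opnorm (H \<theta>) (H \<theta>)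
             (op_diff (H \<theta>)
                ((B_op (H \<theta>) (M \<theta>) (A \<theta>) \<epsilon>)\<inverse>)
                (emb (N \<theta>) \<cdot>\<^sub>o (BN_op (H \<theta>) (N \<theta>) (M \<theta>) (A \<theta>) \<epsilon>)\<inverse> \<cdot>\<^sub>o emb_adj (H \<theta>) (N \<theta>)))
             \<le> 2 * C\<^sub>R * (1 + Msup / ennreal c)\<^sup>2 * ennreal \<epsilon>"
proof (intro allI ballI impI)
  fix \<epsilon> :: real and \<theta>
  assume \<theta>: "\<theta> \<in> \<Theta>" and "0 < \<epsilon> \<and> ennreal \<epsilon> < \<epsilon>\<^sub>0"
  then have \<epsilon>: "\<epsilon> > 0" by simp
  note hilbert = assms(2)[OF \<theta>] and M = assms(3)[OF \<theta>] and A_linear = assms(6)[OF \<theta>]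
    and dense = assms(7)[OF \<theta>] and c = assms(9) and ge = assms(10)[OF \<theta>] and A = assms(11)[OF \<theta>]
    and N = assms(12)[OF \<theta>] and R = assms(13)[OF \<theta>] and fin = assms(14)[OF \<theta>]
    and reducing = assms(15)[OF \<theta>, unfolded R] and inv = assms(16)[OF \<theta>, unfolded R]
  interpret complex_hilbert_space "H \<theta>" by (rule hilbert)
  interpret reduced_skew_selfadjoint "H \<theta>" "A \<theta>" "N \<theta>"
    by unfold_locales (fact skew_selfadjoint_if_eq_uminus_adjoint[OF A] N reducing)+
  define m C where "m = enn2real Msup" and "C = enn2real C\<^sub>R"
  have Msup: "Msup = ennreal m" and C\<^sub>R: "C\<^sub>R = ennreal C" and nonneg: "m \<ge> 0" "C \<ge> 0"
    using assms(5,18) by (simp_all add: m_def C_def)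
  have "opnorm (H \<theta>) (H \<theta>) (M \<theta>) \<le> Msup" unfolding assms(4) using \<theta> by (rule SUP_upper)
  then have Mm: "opnorm (H \<theta>) (H \<theta>) (M \<theta>) \<le> ennreal m" by (simp add: Msup)
  have "opnorm (subsp (H \<theta>) (R \<theta>)) (subsp (H \<theta>) (R \<theta>)) ((compression (H \<theta>) (R \<theta>) (A \<theta>))\<inverse>) \<le> C\<^sub>R"
    unfolding assms(17) using \<theta> by (rule SUP_upper)
  then have AC: "opnorm (H \<theta>) (H \<theta>) ((compression (H \<theta>) (orth_complement (H \<theta>) (N \<theta>)) (A \<theta>))\<inverse>)
      \<le> ennreal C" by (simp add: R C\<^sub>R)
  note estimate = resolvent_estimate[OF M Mm nonneg(1) accretive_if_re_op_ge[OF M ge] c dense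
      linear_operatorD(2)[OF A_linear] fin inv AC nonneg(2) \<epsilon>]
  have "ennreal (C * (1 + m / c)\<^sup>2 * \<epsilon>) \<le> ennreal (2 * C * (1 + m / c)\<^sup>2 * \<epsilon>)"
    using nonneg \<epsilon> by (intro ennreal_leI mult_right_mono) simp_all
  also have "\<dots> = 2 * C\<^sub>R * (1 + Msup / ennreal c)\<^sup>2 * ennreal \<epsilon>"
  proof -
    have "1 + Msup / ennreal c = ennreal (1 + m / c)"
      using nonneg c by (simp add: Msup divide_ennreal)
    moreover have "1 + m / c \<ge> 0" using nonneg c by simp
    ultimately have sq: "(1 + Msup / ennreal c)\<^sup>2 = ennreal ((1 + m / c)\<^sup>2)"
      by (simp only: ennreal_power)
    show ?thesis unfolding sq C\<^sub>R using nonneg c \<epsilon> by (simp add: ennreal_mult)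
  qed
  finally have le: "ennreal (C * (1 + m / c)\<^sup>2 * \<epsilon>)
      \<le> 2 * C\<^sub>R * (1 + Msup / ennreal c)\<^sup>2 * ennreal \<epsilon>" .
  show "(B_op (H \<theta>) (M \<theta>) (A \<theta>) \<epsilon>)\<inverse> \<in> bounded_ops (H \<theta>) (H \<theta>) \<and>
           BN_op (H \<theta>) (N \<theta>) (M \<theta>) (A \<theta>) \<epsilon>
             \<in> bounded_ops (subsp (H \<theta>) (N \<theta>)) (subsp (H \<theta>) (N \<theta>)) \<and>
           (BN_op (H \<theta>) (N \<theta>) (M \<theta>) (A \<theta>) \<epsilon>)\<inverse>
             \<in> bounded_ops (subsp (H \<theta>) (N \<theta>)) (subsp (H \<theta>) (N \<theta>)) \<and>
           opnorm (H \<theta>) (H \<theta>)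
             (op_diff (H \<theta>)
                ((B_op (H \<theta>) (M \<theta>) (A \<theta>) \<epsilon>)\<inverse>)
                (emb (N \<theta>) \<cdot>\<^sub>o (BN_op (H \<theta>) (N \<theta>) (M \<theta>) (A \<theta>) \<epsilon>)\<inverse> \<cdot>\<^sub>o emb_adj (H \<theta>) (N \<theta>)))
             \<le> 2 * C\<^sub>R * (1 + Msup / ennreal c)\<^sup>2 * ennreal \<epsilon>"
    by (intro conjI estimate(1-3) order_trans[OF estimate(4) le])
qed

end
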